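(* Let $n\geq3$. Then the number $p_n$ of inequivalent integer polygons with perimeter $n$ is \[ p_n = \sum_{d\mid n}\frac{\varphi(d)\cdot2^{n/d-1}}n + 2^{\lfloor (n-3)/2\rfloor} - \begin{cases} 3\cdot2^{\lfloor (n-4)/4\rfloor} &\text{if $n\equiv0$ or $1\pmod 4$},\\ 2^{\lfloor (n+2)/4\rfloor} &\text{if $n\equiv2$ or $3\pmod 4$.} \end{cases} \]
   Context: An integer polygon is a polygon (with any number $m\geq3$ of sides) whose side lengths are all positive integers; its perimeter is the sum of its side lengths. Reading the side lengths of an $m$-gon starting from any side, clockwise or anticlockwise, gives an $m$-tuple; two polygons are equivalent if they have the same number $m$ of sides and the $m$-tuple of one can be obtained from that of the other by cyclically re-ordering and/or reversing the entries. (The side-length tuples of integer polygons of perimeter $n$ are exactly the tuples of length $m\geq3$ of positive integers summing to $n$ with every entry less than $n/2$.) $\varphi$ is Euler's totient function and $\lfloor x\rfloor$ the floor. *)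

theory Defs
  imports "HOL-Analysis.Analysis" "HOL-Number_Theory.Number_Theory"
begin

text \<open>
  A polygon is given by the list of its vertices in the Euclidean plane, taken as \<^typ>\<open>complex\<close>,
  in the order in which they are traversed.
\<close>

definition next_vertex :: "complex list \<Rightarrow> nat \<Rightarrow> complex" where
  "next_vertex vs i = vs ! (Suc i mod length vs)"

definition side :: "complex list \<Rightarrow> nat \<Rightarrow> complex set" where
  "side vs i = closed_segment (vs ! i) (next_vertex vs i)"

text \<open>
  Two different sides meet only in a common vertex, and there is no straight angle at a vertex,
  so that the number of sides is the number of vertices.
\<close>

definition polygon :: "complex list \<Rightarrow> bool" where
  "polygon vs \<longleftrightarrow>
     3 \<le> length vs \<and> distinct vs \<and>
     (\<forall>i < length vs. \<forall>j < length vs. i \<noteq> j \<longrightarrow>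
        side vs i \<inter> side vs j = {vs ! i, next_vertex vs i} \<inter> {vs ! j, next_vertex vs j}) \<and>
     (\<forall>i < length vs.
        \<not> collinear {vs ! i, next_vertex vs i, next_vertex vs (Suc i mod length vs)})"

definition side_lengths :: "complex list \<Rightarrow> real list" where
  "side_lengths vs = map (\<lambda>i. dist (vs ! i) (next_vertex vs i)) [0..<length vs]"

definition perimeter :: "complex list \<Rightarrow> real" where
  "perimeter vs = sum_list (side_lengths vs)"

definition integer_polygon :: "complex list \<Rightarrow> bool" where
  "integer_polygon vs \<longleftrightarrow> polygon vs \<and> (\<forall>l \<in> set (side_lengths vs). l \<in> \<int> \<and> l > 0)"

definition polygon_equiv :: "complex list \<Rightarrow> complex list \<Rightarrow> bool" where
  "polygon_equiv vs ws \<longleftrightarrow>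
     length vs = length ws \<and>
     (\<exists>k. side_lengths ws = rotate k (side_lengths vs) \<or>
          side_lengths ws = rotate k (rev (side_lengths vs)))"

definition integer_polygons :: "nat \<Rightarrow> complex list set" where
  "integer_polygons n = {vs. integer_polygon vs \<and> perimeter vs = real n}"

definition polygon_rel :: "nat \<Rightarrow> (complex list \<times> complex list) set" where
  "polygon_rel n =
     {(vs, ws). vs \<in> integer_polygons n \<and> ws \<in> integer_polygons n \<and> polygon_equiv vs ws}"

definition num_integer_polygons :: "nat \<Rightarrow> nat" where
  "num_integer_polygons n = card (integer_polygons n // polygon_rel n)"

lemma rotate_inverse: "\<exists>j. rotate j (rotate k xs) = xs"
proof (cases "xs = []")
  case False
  then have "rotate (length xs - k mod length xs) (rotate (k mod length xs) xs) = xs"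
    by (simp add: rotate_rotate)
  then show ?thesis
    by (metis rotate_conv_mod)
qed simp

lemma rev_rotate_ex: "\<exists>j. rev (rotate k xs) = rotate j (rev xs)"
proof -
  obtain j where "rotate j (rotate k (rev (rotate k xs))) = rev (rotate k xs)"
    using rotate_inverse by blast
  moreover have "\<exists>j. rotate j (rev (rotate k xs)) = rev xs"
    by (metis rotate_inverse rotate_rev rev_rev_ident)
  ultimately show ?thesis
    by (metis rotate_inverse)
qed

lemma polygon_equiv_refl: "polygon_equiv vs vs"
  unfolding polygon_equiv_def by (metis rotate0 id_apply)

lemma polygon_equiv_sym: "polygon_equiv vs ws \<Longrightarrow> polygon_equiv ws vs"
  unfolding polygon_equiv_def by (metis rotate_inverse rev_rotate_ex rev_rev_ident)

lemma polygon_equiv_trans: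
  "polygon_equiv us vs \<Longrightarrow> polygon_equiv vs ws \<Longrightarrow> polygon_equiv us ws"
  unfolding polygon_equiv_def by (metis rotate_rotate rev_rotate_ex rev_rev_ident)

lemma equiv_polygon_rel: "equiv (integer_polygons n) (polygon_rel n)"
proof (rule equivI)
  show "refl_on (integer_polygons n) (polygon_rel n)"
    by (auto simp: refl_on_def polygon_rel_def polygon_equiv_refl)
  show "polygon_rel n \<subseteq> integer_polygons n \<times> integer_polygons n"
    by (auto simp: polygon_rel_def)
  show "sym (polygon_rel n)"
    by (auto simp: sym_def polygon_rel_def polygon_equiv_sym)
  show "trans (polygon_rel n)"
    unfolding trans_def polygon_rel_def using polygon_equiv_trans by blast
qed

end

theory Submission imports Defs begin

text \<open>
  A cyclic sequence of positive integers is the sequence of side lengths of a polygon iff every entry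
  is less than half the sum. Necessity is the strict triangle inequality. For sufficiency, all sides
  but the longest are placed as consecutive chords of a circle whose radius is chosen so that the
  last side closes the polygon; vertices in increasing angular order are in strictly convex position.

  Compositions of \<open>n\<close> up to rotation and reversal correspond to nonzero binary words of length \<open>n\<close>
  (with \<open>True\<close> marking the first unit of each part) up to the dihedral action, which Burnside's lemma
  counts. A composition with a part \<open>\<ge> n / 2\<close> is, up to symmetry, that part followed by a composition
  of some \<open>j \<le> n / 2\<close> up to reversal; these are counted separately and subtracted.
\<close>

text \<open>Origin of the terms, with \<open>h = n div 2\<close>: rotations in Burnside's count give
  the totient sum, and reflections, after division by \<open>2 * n\<close>, give
  \<open>3 * 2 ^ h / 4\<close> for even \<open>n\<close> and \<open>2 ^ h\<close> for odd
  \<open>n\<close>. The classes with a long part number \<open>2 ^ h / 2\<close> plus 3 or 4 times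
  \<open>2 ^ (h div 2) / 2\<close>, minus 1. The two multiples of \<open>2 ^ h\<close> combine to
  \<open>2 ^ ((n - 3) div 2)\<close>, the choice between 3 and 4 is the parity of \<open>h\<close>
  and hence the case distinction modulo 4, and the 1 cancels against the class of the zero word.

  The obstacle in the geometry is that the centre of the circle may lie inside or outside the
  polygon. Both cases are covered at once by letting the sum of the half central angles of the other
  sides range over all of (0, \<open>pi\<close>), and asking only that its sine match the longest
  side.\<close>

section \<open>Counting orbits\<close>

text \<open>The map \<open>f\<close> has to meet every class rather than every element: the maps
  used below are only shown to reach normalised representatives, such as words beginning with
  \<open>True\<close> or compositions beginning with a long part. \<open>A\<close> may be infinite,
  as the set of integer polygons is.\<close>

lemma card_quotient_transfer:
  assumes R: "equiv A R" and S: "equiv B S"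
    and f: "\<And>x. x \<in> A \<Longrightarrow> f x \<in> B"
    and rel: "\<And>x y. x \<in> A \<Longrightarrow> y \<in> A \<Longrightarrow> (x, y) \<in> R \<longleftrightarrow> (f x, f y) \<in> S"
    and surj: "\<And>b. b \<in> B \<Longrightarrow> \<exists>x\<in>A. (f x, b) \<in> S"
  shows "card (A // R) = card (B // S)"
proof -
  \<comment> \<open>The image of a class lies in one class but may be a proper part of it, so it is
    saturated under \<open>S\<close>.\<close>
  define F where "F = (\<lambda>c. S `` (f ` c))"
  have F: "F (R `` {x}) = S `` {f x}" if x: "x \<in> A" for x
  proof -
    have "x \<in> R `` {x}"
      using R x by (rule equiv_class_self)
    moreover have "(f x, f y) \<in> S" if "y \<in> R `` {x}" for y
      using that rel[OF x] equiv_type[OF R] by auto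
    then have "S `` {f y} = S `` {f x}" if "y \<in> R `` {x}" for y
      using that S by (metis equiv_class_eq)
    ultimately show ?thesis
      unfolding F_def by blast
  qed
  have "bij_betw F (A // R) (B // S)"
  proof (rule bij_betw_imageI)
    show "inj_on F (A // R)"
    proof (rule inj_onI)
      fix c d assume "c \<in> A // R" "d \<in> A // R" and eq: "F c = F d"
      then obtain x y where "x \<in> A" "c = R `` {x}" "y \<in> A" "d = R `` {y}"
        by (meson quotientE)
      with eq show "c = d"
        using F R S f rel by (metis eq_equiv_class_iff)
    qed
    show "F ` (A // R) = B // S"
    proof
      show "F ` (A // R) \<subseteq> B // S"
        by (auto elim!: quotientE simp: F intro!: quotientI f)
      show "B // S \<subseteq> F ` (A // R)"
      proof
        fix c assume "c \<in> B // S"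
        then obtain b where b: "b \<in> B" "c = S `` {b}"
          by (meson quotientE)
        with surj obtain x where x: "x \<in> A" "(f x, b) \<in> S" by blast
        then have "c = F (R `` {x})"
          using F S b by (simp add: equiv_class_eq)
        with x show "c \<in> F ` (A // R)"
          by (auto intro: quotientI)
      qed
    qed
  qed
  then show ?thesis
    by (rule bij_betw_same_card)
qed

text \<open>In place of a group there is a family of maps in which composing with a member permutes
  the indices (\<open>mult\<close>). Different indices may act identically, which happens for the
  dihedral action on words of length 1 or 2.\<close>

lemma burnside:
  fixes act :: "'i \<Rightarrow> 'x \<Rightarrow> 'x"
  assumes I: "finite I" and X: "finite X"
    and closed: "\<And>i x. i \<in> I \<Longrightarrow> x \<in> X \<Longrightarrow> act i x \<in> X"
    and inj: "\<And>i. i \<in> I \<Longrightarrow> inj_on (act i) X"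
    and mult: "\<And>j. j \<in> I \<Longrightarrow>
      \<exists>\<pi>. bij_betw \<pi> I I \<and> (\<forall>i\<in>I. \<forall>x\<in>X. act (\<pi> i) x = act j (act i x))"
    and eq: "equiv X R"
    and R: "\<And>x y. x \<in> X \<Longrightarrow> y \<in> X \<Longrightarrow> (x, y) \<in> R \<longleftrightarrow> (\<exists>i\<in>I. y = act i x)"
  shows "(\<Sum>i\<in>I. card {x \<in> X. act i x = x}) = card I * card (X // R)"
proof -
  define stab where "stab x = {i \<in> I. act i x = x}" for x
  have fibre: "card {i \<in> I. act i x = y} = card (stab x)" if x: "x \<in> X" and y: "(x, y) \<in> R" for x y
  proof -
    have "y \<in> X" using equiv_type[OF eq] y by auto
    then obtain j where j: "j \<in> I" "y = act j x"
      using R x y by auto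
    obtain \<pi> where \<pi>: "bij_betw \<pi> I I" "\<forall>i\<in>I. \<forall>x\<in>X. act (\<pi> i) x = act j (act i x)"
      using mult[OF j(1)] by blast
    \<comment> \<open>Composition with \<open>j\<close> carries the indices fixing \<open>x\<close>
      to those sending \<open>x\<close> to \<open>y\<close>, as in a coset of the
      stabiliser.\<close>
    have "bij_betw \<pi> (stab x) {i \<in> I. act i x = y}"
    proof (rule bij_betw_imageI)
      show "inj_on \<pi> (stab x)"
        using \<pi>(1) by (auto simp: bij_betw_def stab_def intro: inj_on_subset)
      show "\<pi> ` stab x = {i \<in> I. act i x = y}"
      proof (intro Set.set_eqI iffI)
        fix i assume "i \<in> {i \<in> I. act i x = y}"
        moreover then obtain i' where "i' \<in> I" "i = \<pi> i'"
          using \<pi>(1) by (metis (no_types, lifting) bij_betw_imp_surj_on imageE mem_Collect_eq)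
        ultimately have "act j (act i' x) = act j x" "i' \<in> I" "i = \<pi> i'"
          using \<pi>(2) x j by auto
        then show "i \<in> \<pi> ` stab x"
          using inj[OF j(1)] closed x by (auto simp: stab_def dest: inj_onD)
      next
        fix i assume "i \<in> \<pi> ` stab x"
        then show "i \<in> {i \<in> I. act i x = y}"
          using \<pi> j x by (auto simp: stab_def bij_betw_apply)
      qed
    qed
    then show ?thesis by (simp add: bij_betw_same_card)
  qed
  have fin: "finite (R `` {x})" for x
    using equiv_type[OF eq] X by (auto intro: finite_subset)
  have orbit_stab: "card (R `` {x}) * card (stab x) = card I" if x: "x \<in> X" for x
  proof -
    have "I = (\<Union>y\<in>R `` {x}. {i \<in> I. act i x = y})"
      using R x closed by auto
    then have "card I = card (\<Union>y\<in>R `` {x}. {i \<in> I. act i x = y})"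
      by simp
    also have "\<dots> = (\<Sum>y\<in>R `` {x}. card {i \<in> I. act i x = y})"
      by (rule card_UN_disjoint) (use fin I in auto)
    also have "\<dots> = (\<Sum>y\<in>R `` {x}. card (stab x))"
      by (rule sum.cong) (use fibre x in auto)
    finally show ?thesis by simp
  qed
  have class_sum: "(\<Sum>x\<in>c. card (stab x)) = card I" if c: "c \<in> X // R" for c
  proof -
    obtain x where x: "x \<in> X" "c = R `` {x}"
      using c by (meson quotientE)
    have "card c * card (stab y) = card I" if "y \<in> c" for y
    proof -
      have "R `` {y} = c" "y \<in> X"
        using that x eq equiv_type[OF eq] by (auto simp: equiv_class_eq_iff)
      then show ?thesis using orbit_stab by blast
    qed
    \<comment> \<open>Multiplying by \<open>card c\<close> avoids the division in
      \<open>card (stab x) = card I / card c\<close>.\<close>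
    then have "card c * (\<Sum>x\<in>c. card (stab x)) = card c * card I"
      by (simp add: sum_distrib_left)
    moreover have "card c > 0"
      using x fin eq by (metis card_gt_0_iff empty_iff equiv_class_self)
    ultimately show ?thesis by simp
  qed
  \<comment> \<open>Double counting of the pairs of an index and a point fixed by it.\<close>
  have "(\<Sum>i\<in>I. card {x \<in> X. act i x = x}) = (\<Sum>i\<in>I. \<Sum>x\<in>X. if act i x = x then 1 else 0)"
    using X by (simp add: sum.If_cases Int_def)
  also have "\<dots> = (\<Sum>x\<in>X. \<Sum>i\<in>I. if act i x = x then 1 else 0)"
    by (rule sum.swap)
  also have "\<dots> = (\<Sum>x\<in>X. card (stab x))"
    using I by (simp add: sum.If_cases Int_def stab_def)
  also have "\<dots> = (\<Sum>x\<in>\<Union>(X // R). card (stab x))"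
    using Union_quotient[OF eq] by simp
  also have "\<dots> = (\<Sum>c\<in>X // R. \<Sum>x\<in>c. card (stab x))"
  proof (rule sum.Union_disjoint[unfolded comp_def])
    show "\<forall>c\<in>X // R. finite c"
      using fin by (auto elim!: quotientE)
    show "\<forall>c\<in>X // R. \<forall>d\<in>X // R. c \<noteq> d \<longrightarrow> c \<inter> d = {}"
      using quotient_disj[OF eq] by blast
  qed
  also have "\<dots> = card I * card (X // R)"
    using class_sum by simp
  finally show ?thesis .
qed

text \<open>The relation of \<open>polygon_equiv\<close>, detached from polygons so that it serves
  for binary words, compositions and real side lengths alike.\<close>

definition dihedral :: "'a list \<Rightarrow> 'a list \<Rightarrow> bool" where
  "dihedral xs ys \<longleftrightarrow> (\<exists>k. ys = rotate k xs \<or> ys = rotate k (rev xs))"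

definition dihedral_rel :: "'a list set \<Rightarrow> ('a list \<times> 'a list) set" where
  "dihedral_rel A = {(xs, ys). xs \<in> A \<and> ys \<in> A \<and> dihedral xs ys}"

lemma dihedral_refl: "dihedral xs xs"
  unfolding dihedral_def by (metis rotate0 id_apply)

lemma dihedral_rotate: "dihedral xs (rotate k xs)"
  unfolding dihedral_def by blast

lemma dihedral_sym: "dihedral xs ys \<Longrightarrow> dihedral ys xs"
  unfolding dihedral_def by (metis rotate_inverse rev_rotate_ex rev_rev_ident)

lemma dihedral_trans: "dihedral xs ys \<Longrightarrow> dihedral ys zs \<Longrightarrow> dihedral xs zs"
  unfolding dihedral_def by (metis rotate_rotate rev_rotate_ex rev_rev_ident)

lemma dihedral_mset: "dihedral xs ys \<Longrightarrow> mset ys = mset xs"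
  unfolding dihedral_def by (auto simp: rotate_drop_take) (metis append_take_drop_id mset_append mset_rev union_commute)+

lemma dihedral_set: "dihedral xs ys \<Longrightarrow> set ys = set xs"
  by (metis dihedral_mset set_mset_mset)

lemma dihedral_length: "dihedral xs ys \<Longrightarrow> length ys = length xs"
  by (metis dihedral_mset size_mset)

lemma equiv_dihedral_rel: "equiv A (dihedral_rel A)"
proof (rule equivI)
  show "refl_on A (dihedral_rel A)"
    by (auto simp: refl_on_def dihedral_rel_def dihedral_refl)
  show "dihedral_rel A \<subseteq> A \<times> A"
    by (auto simp: dihedral_rel_def)
  show "sym (dihedral_rel A)"
    by (auto simp: sym_def dihedral_rel_def dihedral_sym)
  show "trans (dihedral_rel A)"
    unfolding trans_def dihedral_rel_def using dihedral_trans by blast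
qed

text \<open>An invariant property is constant on classes. Applied once to split off the zero word
  and once to split off the compositions with a long part.\<close>

lemma card_dihedral_split:
  assumes fin: "finite A" and P: "\<And>xs ys. dihedral xs ys \<Longrightarrow> P xs \<Longrightarrow> P ys"
  shows "card (A // dihedral_rel A) =
    card ({xs \<in> A. P xs} // dihedral_rel {xs \<in> A. P xs})
    + card ({xs \<in> A. \<not> P xs} // dihedral_rel {xs \<in> A. \<not> P xs})"
proof -
  let ?B = "{xs \<in> A. P xs}" and ?C = "{xs \<in> A. \<not> P xs}"
  have B: "dihedral_rel A `` {x} = dihedral_rel ?B `` {x}" if "x \<in> ?B" for x
    using that P by (auto simp: dihedral_rel_def)
  have C: "dihedral_rel A `` {x} = dihedral_rel ?C `` {x}" if "x \<in> ?C" for x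
    using that P dihedral_sym by (auto simp: dihedral_rel_def)
  have "A // dihedral_rel A = (\<Union>x\<in>?B. {dihedral_rel A `` {x}}) \<union> (\<Union>x\<in>?C. {dihedral_rel A `` {x}})"
    unfolding quotient_def by blast
  also have "\<dots> = ?B // dihedral_rel ?B \<union> ?C // dihedral_rel ?C"
    unfolding quotient_def using B C by simp
  finally have "A // dihedral_rel A = ?B // dihedral_rel ?B \<union> ?C // dihedral_rel ?C" .
  moreover have "?B // dihedral_rel ?B \<inter> ?C // dihedral_rel ?C = {}"
  proof -
    have "c \<subseteq> ?B" "c \<noteq> {}" if "c \<in> ?B // dihedral_rel ?B" for c
      using that equiv_dihedral_rel[of ?B] by (auto elim!: quotientE simp: dihedral_rel_def intro: dihedral_refl)
    moreover have "c \<subseteq> ?C" if "c \<in> ?C // dihedral_rel ?C" for c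
      using that by (auto elim!: quotientE simp: dihedral_rel_def)
    ultimately show ?thesis by blast
  qed
  moreover have "finite (?B // dihedral_rel ?B)" "finite (?C // dihedral_rel ?C)"
    using fin by (auto intro!: finite_quotient simp: dihedral_rel_def)
  ultimately show ?thesis
    by (simp add: card_Un_disjoint)
qed

section \<open>Binary words under the dihedral action\<close>

definition words :: "nat \<Rightarrow> bool list set" where
  "words n = {w. length w = n}"

lemma card_words: "card (words n) = 2 ^ n"
  using card_lists_length_eq[of "UNIV :: bool set" n] by (simp add: words_def)

lemma finite_words: "finite (words n)"
  using finite_lists_length_eq[of "UNIV :: bool set" n] by (simp add: words_def)

lemma palindrome_Cons_snoc_iff: "rev (a # p @ [b]) = a # p @ [b] \<longleftrightarrow> a = b \<and> rev p = p"
  by auto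

lemma card_palindromes: "card {w \<in> words n. rev w = w} = 2 ^ ((n + 1) div 2)"
proof (induction n rule: less_induct)
  case (less n)
  consider "n = 0" | "n = 1" | m where "n = Suc (Suc m)"
    by (metis One_nat_def not0_implies_Suc)
  then show ?case
  proof cases
    case 1
    then have "{w \<in> words n. rev w = w} = {[]}" by (auto simp: words_def)
    with 1 show ?thesis by simp
  next
    case 2
    then have "{w \<in> words n. rev w = w} = {[True], [False]}"
      by (auto simp: words_def length_Suc_conv)
    with 2 show ?thesis by simp
  next
    case 3
    let ?f = "\<lambda>(a, p). a # p @ [a :: bool]"
    let ?P = "{w \<in> words m. rev w = w}"
    have "{w \<in> words n. rev w = w} = ?f ` (UNIV \<times> ?P)"
    proof (intro Set.set_eqI iffI)
      fix w assume w: "w \<in> {w \<in> words n. rev w = w}"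
      then obtain a u where "w = a # u" "length u = Suc m"
        using 3 by (auto simp: words_def length_Suc_conv)
      moreover then obtain p b where "u = p @ [b]" "length p = m"
        by (metis length_Suc_conv_rev)
      ultimately have ab: "w = a # p @ [b]" "length p = m" by simp_all
      have "rev w = w" using w by simp
      then have "a = b \<and> rev p = p"
        unfolding ab(1) palindrome_Cons_snoc_iff .
      then have "w = ?f (a, p)" "p \<in> ?P"
        using ab by (simp_all add: words_def)
      then show "w \<in> ?f ` (UNIV \<times> ?P)" by blast
    qed (use 3 in \<open>auto simp: words_def\<close>)
    moreover have "inj_on ?f (UNIV \<times> ?P)"
      by (auto simp: inj_on_def)
    ultimately have "card {w \<in> words n. rev w = w} = 2 * card ?P"
      by (simp add: card_image card_cartesian_product)
    with 3 less show ?thesis by simp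
  qed
qed

section \<open>Words fixed by a rotation\<close>

lemma rotate_mult_fixed: "rotate k w = w \<Longrightarrow> rotate (j * k) w = w"
  by (induction j) (simp_all add: rotate_rotate[symmetric])

text \<open>The rotations fixing \<open>w\<close> are closed under composition and include the one
  by \<open>length w\<close>, so Bezout's identity puts the gcd among them.\<close>

lemma rotate_fixed_iff_gcd: "rotate k w = w \<longleftrightarrow> rotate (gcd (length w) k) w = w"
proof
  assume k: "rotate k w = w"
  show "rotate (gcd (length w) k) w = w"
  proof (cases "k = 0")
    case False
    obtain x y where "k * x = length w * y + gcd k (length w)"
      using bezout_nat[OF False] by blast
    then have "rotate (length w * y + gcd k (length w)) w = w"
      using rotate_mult_fixed[OF k, of x] by (simp add: mult.commute)
    then show ?thesis
      by (metis rotate_conv_mod mod_mult_self4 gcd.commute)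
  qed simp
next
  assume "rotate (gcd (length w) k) w = w"
  then show "rotate k w = w"
    using rotate_mult_fixed[of "gcd (length w) k" w "k div gcd (length w) k"] by simp
qed

text \<open>A fixed word has period \<open>gcd n k\<close>, a divisor of \<open>n\<close>; it is the
  repetition of its first \<open>gcd n k\<close> letters, which are arbitrary.\<close>

lemma card_words_rotate_fixed:
  assumes n: "n > 0"
  shows "card {w \<in> words n. rotate k w = w} = 2 ^ gcd n k"
proof -
  define g where "g = gcd n k"
  have g: "g > 0" "g dvd n" "g \<le> n" using n by (auto simp: g_def intro: gcd_le1_nat)
  have per: "w ! i = w ! (i mod g)" if w: "length w = n" "rotate g w = w" and i: "i < n" for w :: "bool list" and i
  proof -
    have "rotate (i div g * g) w ! (i mod g) = w ! ((i mod g + i div g * g) mod n)"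
      using nth_rotate[of "i mod g" w "i div g * g"] w g
      by (metis add.commute less_le_trans mod_less_divisor)
    then show ?thesis
      using rotate_mult_fixed[OF w(2), of "i div g"] i by simp
  qed
  have "bij_betw (take g) {w \<in> words n. rotate k w = w} (words g)"
  proof (rule bij_betw_imageI)
    show "inj_on (take g) {w \<in> words n. rotate k w = w}"
    proof (rule inj_onI)
      fix u v assume u: "u \<in> {w \<in> words n. rotate k w = w}" and v: "v \<in> {w \<in> words n. rotate k w = w}"
        and eq: "take g u = take g v"
      have "length u = n" "length v = n" "rotate g u = u" "rotate g v = v"
        using u v rotate_fixed_iff_gcd[of k u] rotate_fixed_iff_gcd[of k v] by (auto simp: words_def g_def)
      moreover have "u ! (i mod g) = v ! (i mod g)" for i
        using eq g by (metis mod_less_divisor nth_take)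
      ultimately show "u = v"
        using per[of u] per[of v] by (intro nth_equalityI) simp_all
    qed
    show "take g ` {w \<in> words n. rotate k w = w} = words g"
    proof
      show "take g ` {w \<in> words n. rotate k w = w} \<subseteq> words g"
        using g by (auto simp: words_def)
      show "words g \<subseteq> take g ` {w \<in> words n. rotate k w = w}"
      proof
        fix u :: "bool list" assume "u \<in> words g"
        then have u: "length u = g" by (simp add: words_def)
        define w where "w = map (\<lambda>i. u ! (i mod g)) [0..<n]"
        have "rotate g w = w"
        proof (rule nth_equalityI)
          fix i assume "i < length (rotate g w)"
          moreover have "(g + i) mod n mod g = i mod g" for i
            using g by (simp add: mod_mod_cancel)
          ultimately show "rotate g w ! i = w ! i"
            using n by (simp add: nth_rotate w_def)
        qed simp
        then have "rotate k w = w"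
          using rotate_fixed_iff_gcd[of k w] by (simp add: w_def g_def)
        moreover have "take g w = u"
          using u g by (auto simp: w_def intro!: nth_equalityI)
        moreover have "w \<in> words n" by (simp add: w_def words_def)
        ultimately show "u \<in> take g ` {w \<in> words n. rotate k w = w}" by force
      qed
    qed
  qed
  then show ?thesis
    by (simp add: bij_betw_same_card card_words flip: g_def)
qed

lemma sum_over_gcd:
  fixes f :: "nat \<Rightarrow> nat"
  assumes n: "n > 0"
  shows "(\<Sum>k<n. f (gcd n k)) = (\<Sum>d | d dvd n. totient d * f (n div d))"
proof -
  \<comment> \<open>The index 0 is exchanged for \<open>n\<close>, which has the same gcd with
    \<open>n\<close>, because \<open>card_gcd_eq_totient\<close> counts in
    \<open>{0<..n}\<close>.\<close>
  have "(\<Sum>k<n. f (gcd n k)) = (\<Sum>k\<in>{0<..n}. f (gcd n k))"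
  proof (rule sum.reindex_bij_witness[where i = "\<lambda>k. k mod n" and j = "\<lambda>k. if k = 0 then n else k"])
  qed (use n in \<open>auto simp: gcd.commute[of n] gcd_red_nat[symmetric] le_less\<close>)
  also have "\<dots> = (\<Sum>d | d dvd n. \<Sum>k | k \<in> {0<..n} \<and> gcd n k = d. f (gcd n k))"
    by (rule sum.group[symmetric]) (use n in auto)
  also have "\<dots> = (\<Sum>d | d dvd n. totient (n div d) * f d)"
  proof (rule sum.cong)
    fix d assume d: "d \<in> {d. d dvd n}"
    have "{k. k \<in> {0<..n} \<and> gcd n k = d} = {k \<in> {0<..n}. gcd k n = d}"
      by (auto simp: gcd.commute)
    then have "card {k. k \<in> {0<..n} \<and> gcd n k = d} = totient (n div d)"
      using card_gcd_eq_totient[of n d] d n by simp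
    then show "(\<Sum>k | k \<in> {0<..n} \<and> gcd n k = d. f (gcd n k)) = totient (n div d) * f d"
      by simp
  qed simp
  also have "\<dots> = (\<Sum>d | d dvd n. totient d * f (n div d))"
    by (rule sum.reindex_bij_witness[where i = "\<lambda>d. n div d" and j = "\<lambda>d. n div d"])
       (use n in \<open>auto elim!: dvdE\<close>)
  finally show ?thesis .
qed

text \<open>Reversal followed by this rotation reverses the two blocks in place. So every reflection
  of a cyclic word reverses two complementary arcs, and its fixed words are pairs of
  palindromes.\<close>

lemma rotate_rev_fixed_iff:
  assumes "length b = k"
  shows "rotate k (rev (a @ b)) = a @ b \<longleftrightarrow> rev a = a \<and> rev b = b"
proof -
  have "rotate k (rev (a @ b)) = rev a @ rev b"
    using rotate_append[of "rev b" "rev a"] assms by simp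
  then show ?thesis by simp
qed

lemma card_words_reflection_fixed:
  assumes "k \<le> n"
  shows "card {w \<in> words n. rotate k (rev w) = w} = 2 ^ ((n - k + 1) div 2 + (k + 1) div 2)"
proof -
  let ?A = "{a \<in> words (n - k). rev a = a}" and ?B = "{b \<in> words k. rev b = b}"
  have "{w \<in> words n. rotate k (rev w) = w} = (\<lambda>(a, b). a @ b) ` (?A \<times> ?B)"
  proof (intro Set.set_eqI iffI)
    fix w assume w: "w \<in> {w \<in> words n. rotate k (rev w) = w}"
    define a b where "a = take (n - k) w" and "b = drop (n - k) w"
    have "w = a @ b" "length a = n - k" "length b = k"
      using w assms by (auto simp: a_def b_def words_def)
    with w rotate_rev_fixed_iff[of b k a] show "w \<in> (\<lambda>(a, b). a @ b) ` (?A \<times> ?B)"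
      by (auto simp: words_def)
  next
    fix w assume "w \<in> (\<lambda>(a, b). a @ b) ` (?A \<times> ?B)"
    then obtain a b where "w = a @ b" "a \<in> ?A" "b \<in> ?B" by auto
    then show "w \<in> {w \<in> words n. rotate k (rev w) = w}"
      using rotate_rev_fixed_iff[of b k a] assms by (auto simp: words_def)
  qed
  moreover have "inj_on (\<lambda>(a, b). a @ b) (?A \<times> ?B)"
    by (auto simp: inj_on_def words_def)
  ultimately show ?thesis
    by (simp add: card_image card_cartesian_product card_palindromes power_add)
qed

text \<open>Reversal conjugates a rotation into its inverse, written with a natural exponent as
  \<open>length u - l\<close>.\<close>

lemma rev_rotate:
  assumes "l \<le> length u"
  shows "rev (rotate l u) = rotate (length u - l) (rev u)"
proof -
  have "rotate l u = drop l u @ take l u"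
    using assms rotate_append[of "take l u" "drop l u"] by simp
  moreover have "rotate (length u - l) (rev u) = rev (take l u) @ rev (drop l u)"
    using assms rotate_append[of "rev (drop l u)" "rev (take l u)"]
    by (simp flip: rev_append)
  ultimately show ?thesis by simp
qed

lemma rotate_injective: "rotate k x = rotate k y \<Longrightarrow> x = y"
proof (induction k)
  case (Suc k)
  then show ?case by (auto dest: injD[OF inj_rotate1])
qed simp

lemma card_bracelets:
  assumes n: "n > 0"
  shows "2 * n * card (words n // dihedral_rel (words n)) =
    (\<Sum>d | d dvd n. totient d * 2 ^ (n div d))
    + (\<Sum>k<n. 2 ^ ((n - k + 1) div 2 + (k + 1) div 2))"
proof -
  let ?I = "{..<n} \<times> (UNIV :: bool set)"
  define act :: "nat \<times> bool \<Rightarrow> bool list \<Rightarrow> bool list" where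
    "act = (\<lambda>(k, b) w. rotate k (if b then rev w else w))"
  have "(\<Sum>i\<in>?I. card {w \<in> words n. act i w = w}) =
      card ?I * card (words n // dihedral_rel (words n))"
  proof (rule burnside)
    show "finite ?I" by simp
    show "finite (words n)" by (rule finite_words)
    show "act i x \<in> words n" if "i \<in> ?I" "x \<in> words n" for i x
      using that by (auto simp: act_def words_def split: prod.splits)
    show "inj_on (act i) (words n)" for i
      by (auto simp: inj_on_def act_def dest: rotate_injective split: prod.splits if_splits)
    show "equiv (words n) (dihedral_rel (words n))" by (rule equiv_dihedral_rel)
    show "(x, y) \<in> dihedral_rel (words n) \<longleftrightarrow> (\<exists>i\<in>?I. y = act i x)"
      if x: "x \<in> words n" and y: "y \<in> words n" for x y
    proof
      assume "(x, y) \<in> dihedral_rel (words n)"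
      then obtain k where "y = rotate k x \<or> y = rotate k (rev x)"
        by (auto simp: dihedral_rel_def dihedral_def)
      then obtain b where "y = rotate k (if b then rev x else x)"
        by (metis (full_types))
      then have "y = act (k mod n, b) x"
        using x rotate_conv_mod[of k "if b then rev x else x"] by (simp add: act_def words_def split: if_splits)
      with n show "\<exists>i\<in>?I. y = act i x" by force
    next
      assume "\<exists>i\<in>?I. y = act i x"
      with x y show "(x, y) \<in> dihedral_rel (words n)"
        by (auto simp: act_def dihedral_rel_def dihedral_def split: if_splits)
    qed
    fix j assume "j \<in> ?I"
    then obtain k b where j: "j = (k, b)" "k < n" by auto
    \<comment> \<open>The multiplication table of the dihedral group: a reversal performed after the
      rotation by \<open>l\<close> turns it into the rotation by \<open>n - l\<close>.\<close>
    define \<pi> where "\<pi> = (\<lambda>(l, c). if b then ((k + (n - l)) mod n, \<not> c) else ((k + l) mod n, c :: bool))"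
    have "bij_betw \<pi> ?I ?I"
    proof -
      have "inj_on \<pi> ?I"
      proof (rule inj_onI)
        fix p q assume p: "p \<in> ?I" and q: "q \<in> ?I" and eq: "\<pi> p = \<pi> q"
        obtain l c l' c' where pq: "p = (l, c)" "q = (l', c')" by fastforce
        show "p = q"
        proof (cases b)
          case True
          then have "[k + (n - l) = k + (n - l')] (mod n)" "c = c'"
            using eq by (auto simp: pq \<pi>_def cong_def)
          \<comment> \<open>Adding \<open>l + l'\<close> removes the truncated subtractions, leaving
            \<open>n + l'\<close> and \<open>n + l\<close>.\<close>
          then have "[n - l + (l + l') = n - l' + (l + l')] (mod n)"
            by (metis cong_add_lcancel_nat cong_add_rcancel_nat)
          then have "[l' = l] (mod n)"
            using p q by (simp add: pq cong_def)
          with p q \<open>c = c'\<close> show ?thesis by (simp add: pq cong_def)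
        next
          case False
          then have "[k + l = k + l'] (mod n)" "c = c'"
            using eq by (auto simp: pq \<pi>_def cong_def)
          then have "[l = l'] (mod n)"
            by (metis cong_add_lcancel_nat)
          with p q \<open>c = c'\<close> show ?thesis by (simp add: pq cong_def)
        qed
      qed
      moreover have "\<pi> ` ?I \<subseteq> ?I"
        using n by (auto simp: \<pi>_def split: if_splits)
      ultimately show ?thesis
        by (simp add: bij_betw_def endo_inj_surj)
    qed
    moreover have "act (\<pi> i) x = act j (act i x)" if iI: "i \<in> ?I" and x: "x \<in> words n" for i x
    proof -
      obtain l c where i: "i = (l, c)" "l < n" using iI by auto
      define u where "u = (if c then rev x else x)"
      have u: "length u = n" using x by (simp add: u_def words_def)
      have eq: "(if \<not> c then rev x else x) = rev u" by (simp add: u_def)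
      have "act j (act i x) = rotate k (if b then rev (rotate l u) else rotate l u)"
        by (simp add: act_def i j u_def)
      also have "\<dots> = rotate (k + (if b then n - l else l)) (if b then rev u else u)"
        using u i by (simp add: rev_rotate rotate_rotate)
      also have "\<dots> = act (\<pi> i) x"
        using u rotate_conv_mod[of "k + (n - l)" "rev u"] rotate_conv_mod[of "k + l" u] eq
        by (auto simp: act_def i \<pi>_def u_def)
      finally show ?thesis by simp
    qed
    ultimately show "\<exists>\<pi>. bij_betw \<pi> ?I ?I \<and> (\<forall>i\<in>?I. \<forall>x\<in>words n. act (\<pi> i) x = act j (act i x))"
      by blast
  qed
  moreover have "card ?I = 2 * n" by (simp add: card_cartesian_product)
  moreover have "(\<Sum>i\<in>?I. card {w \<in> words n. act i w = w}) =
      (\<Sum>k<n. card {w \<in> words n. rotate k w = w} + card {w \<in> words n. rotate k (rev w) = w})"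
    unfolding sum.cartesian_product' by (simp add: act_def UNIV_bool add.commute)
  moreover have "\<dots> = (\<Sum>k<n. 2 ^ gcd n k) + (\<Sum>k<n. 2 ^ ((n - k + 1) div 2 + (k + 1) div 2))"
    by (simp add: card_words_rotate_fixed[OF n] card_words_reflection_fixed sum.distrib)
  ultimately show ?thesis
    using sum_over_gcd[OF n, of "\<lambda>g. 2 ^ g"] by simp
qed

section \<open>Compositions as binary words\<close>

definition compositions :: "nat \<Rightarrow> nat list set" where
  "compositions n = {xs. 0 \<notin> set xs \<and> sum_list xs = n}"

text \<open>Because of natural subtraction a part \<open>0\<close> would be coded like a part
  \<open>1\<close>, hence the condition \<open>0 \<notin> set xs\<close> wherever length or
  injectivity matters.\<close>

definition word_of :: "nat list \<Rightarrow> bool list" where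
  "word_of xs = concat (map (\<lambda>k. True # replicate (k - 1) False) xs)"

lemma word_of_simps [simp]:
  "word_of [] = []"
  "word_of (k # xs) = True # replicate (k - 1) False @ word_of xs"
  "word_of (xs @ ys) = word_of xs @ word_of ys"
  by (simp_all add: word_of_def)

lemma length_word_of: "0 \<notin> set xs \<Longrightarrow> length (word_of xs) = sum_list xs"
  by (induction xs) auto

lemma word_of_eq_Nil_iff [simp]: "word_of xs = [] \<longleftrightarrow> xs = []"
  by (cases xs) auto

lemma hd_word_of: "xs \<noteq> [] \<Longrightarrow> hd (word_of xs)"
  by (cases xs) auto

text \<open>The code marks the start of each part but not the end of the last. With a final
  \<open>True\<close> all cut points are marked, and the code becomes symmetric under
  reversal.\<close>

lemma rev_word_of: "rev (word_of xs @ [True]) = word_of (rev xs) @ [True]"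
proof (induction xs)
  case (Cons k xs)
  have "rev (word_of (k # xs) @ [True]) =
      rev (word_of xs @ [True]) @ replicate (k - 1) False @ [True]" by simp
  also have "\<dots> = word_of (rev (k # xs)) @ [True]"
    unfolding Cons.IH by simp
  finally show ?case .
qed simp

text \<open>Decoding is unique: the run of \<open>False\<close> ends exactly where the next block,
  which starts with \<open>True\<close>, begins.\<close>

lemma replicate_False_append_eq:
  assumes "replicate i False @ u = replicate j False @ v"
    and "u = [] \<or> hd u" and "v = [] \<or> hd v"
  shows "i = j \<and> u = v"
  using assms
proof (induction i arbitrary: j)
  case 0
  then show ?case by (cases j) auto
next
  case (Suc i)
  then show ?case by (cases j) auto
qed

lemma word_of_inject:
  "\<lbrakk>0 \<notin> set xs; 0 \<notin> set ys; word_of xs = word_of ys\<rbrakk> \<Longrightarrow> xs = ys"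
proof (induction xs arbitrary: ys)
  case Nil
  then show ?case by (metis word_of_simps(1) word_of_eq_Nil_iff)
next
  case (Cons x xs)
  then obtain y zs where ys: "ys = y # zs"
    by (cases ys) auto
  with Cons.prems have "x - 1 = y - 1 \<and> word_of xs = word_of zs"
    by (intro replicate_False_append_eq) (auto intro: hd_word_of)
  then have "x - 1 = y - 1" "xs = zs"
    using Cons.IH[of zs] Cons.prems ys by simp_all
  moreover have "x > 0" "y > 0"
    using Cons.prems ys by auto
  ultimately show ?case using ys by simp
qed

text \<open>Greedy decoding: the leading \<open>True\<close> with the maximal run of
  \<open>False\<close> after it is the first part, and the rest is empty or again starts with
  \<open>True\<close>.\<close>

lemma word_of_surj: "w = [] \<or> hd w \<Longrightarrow> \<exists>xs. 0 \<notin> set xs \<and> word_of xs = w"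
proof (induction w rule: length_induct)
  case (1 w)
  show ?case
  proof (cases w)
    case Nil
    then show ?thesis by (intro exI[of _ "[]"]) simp
  next
    case (Cons b v)
    define f where "f = takeWhile Not v"
    define r where "r = dropWhile Not v"
    have r: "r = [] \<or> hd r"
      using hd_dropWhile[of Not v] by (auto simp: r_def)
    have "length r < length w"
      by (simp add: r_def Cons length_dropWhile_le le_imp_less_Suc)
    with 1 r obtain ys where "0 \<notin> set ys" "word_of ys = r" by blast
    moreover have "f = replicate (length f) False"
      by (rule replicate_eqI) (auto simp: f_def dest: set_takeWhileD)
    moreover have "w = True # f @ r"
      using Cons 1 by (simp add: f_def r_def)
    ultimately have "word_of (Suc (length f) # ys) = w" "0 \<notin> set (Suc (length f) # ys)"
      by simp_all
    then show ?thesis by blast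
  qed
qed

text \<open>The first letter is always \<open>True\<close>; the other \<open>n - 1\<close> letters
  say, for each gap between neighbouring units, whether the composition is cut there.\<close>

lemma compositions_word_bij:
  assumes "n > 0"
  shows "bij_betw (\<lambda>xs. tl (word_of xs)) (compositions n) (words (n - 1))"
proof (rule bij_betw_imageI)
  have hd: "word_of xs = True # tl (word_of xs)" if "xs \<in> compositions n" for xs
  proof -
    have "xs \<noteq> []" using that assms by (auto simp: compositions_def)
    then show ?thesis using hd_word_of[of xs] by (cases xs) auto
  qed
  show "inj_on (\<lambda>xs. tl (word_of xs)) (compositions n)"
  proof (rule inj_onI)
    fix xs ys assume "xs \<in> compositions n" "ys \<in> compositions n" "tl (word_of xs) = tl (word_of ys)"
    with hd[of xs] hd[of ys] have "word_of xs = word_of ys" by metis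
    with \<open>xs \<in> compositions n\<close> \<open>ys \<in> compositions n\<close> show "xs = ys"
      by (auto simp: compositions_def intro: word_of_inject)
  qed
  show "(\<lambda>xs. tl (word_of xs)) ` compositions n = words (n - 1)"
  proof
    show "(\<lambda>xs. tl (word_of xs)) ` compositions n \<subseteq> words (n - 1)"
      by (auto simp: compositions_def words_def length_word_of)
    show "words (n - 1) \<subseteq> (\<lambda>xs. tl (word_of xs)) ` compositions n"
    proof
      fix u assume u: "u \<in> words (n - 1)"
      obtain xs where xs: "0 \<notin> set xs" "word_of xs = True # u"
        using word_of_surj[of "True # u"] by auto
      then have "sum_list xs = n"
        using length_word_of[OF xs(1)] u assms by (simp add: words_def)
      with xs show "u \<in> (\<lambda>xs. tl (word_of xs)) ` compositions n"
        by (intro image_eqI[of _ _ xs]) (auto simp: compositions_def)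
    qed
  qed
qed

lemma compositions_0: "compositions 0 = {[]}"
  by (auto simp: compositions_def) (metis list.set_sel(1))

lemma finite_compositions: "finite (compositions n)"
proof (cases "n = 0")
  case False
  then show ?thesis
    using compositions_word_bij bij_betw_finite finite_words by blast
qed (simp add: compositions_0)

lemma card_compositions: "n > 0 \<Longrightarrow> card (compositions n) = 2 ^ (n - 1)"
  using bij_betw_same_card[OF compositions_word_bij] card_words by simp

text \<open>After the forced first letter is dropped, reversing a composition is exactly reversing
  its word of gaps, so palindromes correspond to palindromes of length \<open>n - 1\<close>.\<close>

lemma card_palindromic_compositions:
  "card {xs \<in> compositions n. rev xs = xs} = 2 ^ (n div 2)"
proof (cases "n = 0")
  case True
  then have "{xs \<in> compositions n. rev xs = xs} = {[]}"
    by (auto simp: compositions_0)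
  with True show ?thesis by simp
next
  case False
  let ?f = "\<lambda>xs. tl (word_of xs)"
  have bij: "bij_betw ?f (compositions n) (words (n - 1))"
    using False compositions_word_bij by simp
  have rev: "?f (rev xs) = rev (?f xs)" if "xs \<in> compositions n" for xs
  proof -
    have "xs \<noteq> []" using that False by (auto simp: compositions_def)
    then have "word_of xs = True # ?f xs" "word_of (rev xs) = True # ?f (rev xs)"
      using hd_word_of[of xs] hd_word_of[of "rev xs"]
      by (metis list.collapse word_of_eq_Nil_iff rev_is_Nil_conv)+
    then show ?thesis
      using rev_word_of[of xs] by (metis append_Cons append_same_eq list.inject rev.simps(2) rev_eq_Cons_iff rev_rev_ident)
  qed
  have pal: "rev xs = xs \<longleftrightarrow> rev (?f xs) = ?f xs" if "xs \<in> compositions n" for xs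
  proof -
    have "rev xs \<in> compositions n" using that by (simp add: compositions_def sum_list_rev)
    then show ?thesis
      using rev[OF that] bij that by (metis bij_betw_def inj_onD)
  qed
  have "?f ` {xs \<in> compositions n. rev xs = xs} = {w \<in> ?f ` compositions n. rev w = w}"
    using pal by blast
  also have "?f ` compositions n = words (n - 1)"
    using bij by (simp add: bij_betw_def)
  finally have "?f ` {xs \<in> compositions n. rev xs = xs} = {w \<in> words (n - 1). rev w = w}" .
  moreover have "inj_on ?f {xs \<in> compositions n. rev xs = xs}"
    using bij by (auto simp: bij_betw_def intro: inj_on_subset)
  ultimately have "card {xs \<in> compositions n. rev xs = xs} = card {w \<in> words (n - 1). rev w = w}"
    using card_image by fastforce
  then have "card {xs \<in> compositions n. rev xs = xs} = 2 ^ ((n - 1 + 1) div 2)"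
    by (simp only: card_palindromes)
  with False show ?thesis by simp
qed

section \<open>Dihedral classes of compositions and of their words\<close>

lemma dihedral_append_swap: "dihedral (xs @ ys) (ys @ xs)"
  by (metis dihedral_rotate rotate_append)

lemma dihedral_rev: "dihedral xs (rev xs)"
  unfolding dihedral_def by (metis rotate0 id_apply)

lemma dihedral_cases:
  assumes "dihedral xs ys"
  obtains us vs where "xs = us @ vs" "ys = vs @ us" | us vs where "rev xs = us @ vs" "ys = vs @ us"
proof -
  have "\<exists>us vs. zs = us @ vs \<and> rotate k zs = vs @ us" for k and zs :: "'a list"
    by (metis append_take_drop_id rotate_drop_take)
  then show ?thesis
    using assms that unfolding dihedral_def by metis
qed

text \<open>Both words are codes, so \<open>u\<close> and \<open>v\<close> each start with
  \<open>True\<close> or are empty. The cut therefore falls between two blocks and comes from a cut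
  of \<open>xs\<close>.\<close>

lemma word_of_rotation:
  assumes "word_of xs = u @ v" "word_of ys = v @ u" "0 \<notin> set xs" "0 \<notin> set ys"
  shows "dihedral xs ys"
proof -
  have "u = [] \<or> hd u" "v = [] \<or> hd v"
    using assms hd_word_of[of xs] hd_word_of[of ys] by (cases u; cases v; force)+
  then obtain us vs where uv: "0 \<notin> set us" "word_of us = u" "0 \<notin> set vs" "word_of vs = v"
    using word_of_surj by metis
  have "xs = us @ vs" "ys = vs @ us"
    using assms uv by (auto intro!: word_of_inject)
  then show ?thesis using dihedral_append_swap by blast
qed

lemma dihedral_word_of_rev: "dihedral (rev (word_of xs)) (word_of (rev xs))"
proof (cases "xs = []")
  case False
  then obtain v where v: "word_of (rev xs) = True # v"
    using hd_word_of[of "rev xs"] by (metis list.collapse rev_is_Nil_conv word_of_eq_Nil_iff)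
  then have "rev (word_of xs) = v @ [True]"
    using rev_word_of[of xs] by simp
  then show ?thesis
    using v dihedral_append_swap[of v "[True]"] by simp
qed (simp add: dihedral_refl)

lemma dihedral_word_of_iff:
  assumes "0 \<notin> set xs" "0 \<notin> set ys"
  shows "dihedral (word_of xs) (word_of ys) \<longleftrightarrow> dihedral xs ys"
proof
  assume "dihedral (word_of xs) (word_of ys)"
  then show "dihedral xs ys"
  proof (cases rule: dihedral_cases)
    case (1 us vs)
    then show ?thesis using word_of_rotation assms by blast
  next
    case (2 us vs)
    then have "\<exists>k. word_of ys = rotate k (rev (word_of xs))"
      by (metis rotate_append)
    \<comment> \<open>A genuine rotation is required for \<open>word_of_rotation\<close> to apply to
      \<open>rev xs\<close>; the relation in \<open>dihedral_word_of_rev\<close> would also admit a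
      reflection.\<close>
    moreover have "\<exists>k. rev (word_of xs) = rotate k (word_of (rev xs))"
    proof (cases "xs = []")
      case False
      then obtain v where v: "word_of (rev xs) = True # v"
        using hd_word_of[of "rev xs"] by (metis list.collapse rev_is_Nil_conv word_of_eq_Nil_iff)
      then have "rev (word_of xs) = rotate 1 (word_of (rev xs))"
        using rev_word_of[of xs] by simp
      then show ?thesis by blast
    qed simp
    ultimately obtain k where "word_of ys = rotate k (word_of (rev xs))"
      by (metis rotate_rotate)
    then obtain us vs where "word_of (rev xs) = us @ vs" "word_of ys = vs @ us"
      by (metis append_take_drop_id rotate_drop_take)
    then have "dihedral (rev xs) ys"
      using assms by (intro word_of_rotation) auto
    then show ?thesis using dihedral_rev dihedral_trans by blast
  qed
next
  assume "dihedral xs ys"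
  then show "dihedral (word_of xs) (word_of ys)"
  proof (cases rule: dihedral_cases)
    case (1 us vs)
    then show ?thesis using dihedral_append_swap by simp
  next
    case (2 us vs)
    then have "dihedral (word_of (rev xs)) (word_of ys)"
      using dihedral_append_swap by simp
    then show ?thesis
      using dihedral_rev dihedral_word_of_rev dihedral_trans by blast
  qed
qed

text \<open>Any word containing \<open>True\<close> can be rotated to begin with it and is then a
  code. The extra class is that of the all-\<open>False\<close> word.\<close>

lemma card_composition_classes:
  assumes n: "n > 0"
  shows "card (words n // dihedral_rel (words n)) =
    card (compositions n // dihedral_rel (compositions n)) + 1"
proof -
  let ?W = "{w \<in> words n. True \<in> set w}"
  have "card (compositions n // dihedral_rel (compositions n)) = card (?W // dihedral_rel ?W)"
  proof (rule card_quotient_transfer[where f = word_of])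
    show W: "word_of xs \<in> ?W" if "xs \<in> compositions n" for xs
      using that n by (cases xs) (auto simp: compositions_def words_def length_word_of)
    show "(xs, ys) \<in> dihedral_rel (compositions n) \<longleftrightarrow> (word_of xs, word_of ys) \<in> dihedral_rel ?W"
      if "xs \<in> compositions n" "ys \<in> compositions n" for xs ys
      using that W[OF that(1)] W[OF that(2)] dihedral_word_of_iff[of xs ys]
      by (auto simp: dihedral_rel_def compositions_def)
    fix w assume w: "w \<in> ?W"
    then obtain u v where uv: "w = u @ True # v"
      by (auto dest: split_list)
    then obtain xs where xs: "0 \<notin> set xs" "word_of xs = True # v @ u"
      using word_of_surj[of "True # v @ u"] by auto
    then have "xs \<in> compositions n"
      using length_word_of[of xs] w uv by (simp add: compositions_def words_def)
    moreover have "dihedral (word_of xs) w"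
      using dihedral_append_swap[of "True # v" u] by (simp add: uv xs)
    ultimately show "\<exists>xs\<in>compositions n. (word_of xs, w) \<in> dihedral_rel ?W"
      using w W by (auto simp: dihedral_rel_def)
  qed (rule equiv_dihedral_rel)+
  moreover have "{w \<in> words n. True \<notin> set w} = {replicate n False}"
    by (auto simp: words_def intro!: replicate_eqI)
  moreover have "card ({x} // dihedral_rel {x}) = 1" for x :: "bool list"
    by (simp add: singleton_quotient)
  ultimately show ?thesis
    using card_dihedral_split[OF finite_words[of n], of "\<lambda>w. True \<in> set w"]
    by (simp add: dihedral_set)
qed

lemma card_reversal_classes:
  fixes X :: "'a list set"
  assumes "finite X" and "\<And>xs. xs \<in> X \<Longrightarrow> rev xs \<in> X"
    and R: "R = {(xs, ys). xs \<in> X \<and> ys \<in> X \<and> (ys = xs \<or> ys = rev xs)}"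
  shows "2 * card (X // R) = card X + card {xs \<in> X. rev xs = xs}"
proof -
  define act where "act b xs = (if b then rev xs else xs)" for b :: bool and xs :: "'a list"
  have "(\<Sum>b\<in>UNIV. card {xs \<in> X. act b xs = xs}) = card (UNIV :: bool set) * card (X // R)"
  proof (rule burnside)
    show "act i xs \<in> X" if "xs \<in> X" for i xs
      using that assms by (simp add: act_def)
    show "inj_on (act i) X" for i
      by (simp add: inj_on_def act_def)
    show "\<exists>\<pi>. bij_betw \<pi> UNIV UNIV \<and> (\<forall>i\<in>UNIV. \<forall>x\<in>X. act (\<pi> i) x = act j (act i x))" for j
      \<comment> \<open>Inequality of truth values is addition in the two-element group formed by
        the identity and reversal.\<close>
      by (rule exI[of _ "\<lambda>i. i \<noteq> j"])
         (auto simp: act_def bij_def inj_def surj_def)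
    show "equiv X R"
      unfolding R by (rule equivI) (auto simp: refl_on_def sym_def trans_def)
    show "(x, y) \<in> R \<longleftrightarrow> (\<exists>i\<in>UNIV. y = act i x)" if "x \<in> X" "y \<in> X" for x y
      using that by (auto simp: R act_def)
  qed (use assms in auto)
  then show ?thesis
    by (simp add: UNIV_bool act_def add.commute)
qed

section \<open>Compositions with a large part\<close>

lemma dihedral_Cons_rev: "dihedral (k # c) (k # rev c)"
  using dihedral_trans[OF dihedral_rev[of "k # c"]] dihedral_append_swap[of "rev c" "[k]"] by simp

text \<open>A proper rotation that again starts with \<open>k\<close> would bring a second
  \<open>k\<close> to the front. Since the rest sums to at most \<open>k\<close>, that second
  \<open>k\<close> is all of it, and \<open>c\<close> and \<open>d\<close> are both
  \<open>[k]\<close>.\<close>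

lemma rotation_Cons_big:
  fixes c d :: "nat list"
  assumes big: "sum_list c \<le> k" and eq: "k # c = us @ vs" "k # d = vs @ us"
    and pos: "0 \<notin> set c" "0 \<notin> set d"
  shows "c = d"
proof (cases "us = [] \<or> vs = []")
  case True
  with eq show ?thesis by auto
next
  case False
  then obtain us' vs' where uv: "us = k # us'" "vs = k # vs'"
    using eq by (metis append_eq_Cons_conv)
  then have c: "c = us' @ k # vs'" and d: "d = vs' @ k # us'"
    using eq by simp_all
  with big have "sum_list us' = 0" "sum_list vs' = 0" by simp_all
  with pos c d have "us' = []" "vs' = []"
    by (auto simp: sum_list_eq_0_iff) (metis list.set_sel(1))+
  with c d show ?thesis by simp
qed

lemma dihedral_Cons_big_iff:
  fixes c d :: "nat list"
  assumes "sum_list c \<le> k" and pos: "0 \<notin> set c" "0 \<notin> set d"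
  shows "dihedral (k # c) (k # d) \<longleftrightarrow> d = c \<or> d = rev c"
proof
  assume "dihedral (k # c) (k # d)"
  then show "d = c \<or> d = rev c"
  proof (cases rule: dihedral_cases)
    case (1 us vs)
    then show ?thesis using rotation_Cons_big assms by blast
  next
    case (2 us vs)
    then have "\<exists>j. k # d = rotate j (rev c @ [k])"
      by (metis rev.simps(2) rotate_append)
    moreover have "rev c @ [k] = rotate 1 (k # rev c)" by simp
    ultimately obtain j where "k # d = rotate j (k # rev c)"
      by (metis rotate_rotate)
    then obtain us vs where "k # rev c = us @ vs" "k # d = vs @ us"
      by (metis append_take_drop_id rotate_drop_take)
    then have "rev c = d"
      using assms by (intro rotation_Cons_big[of "rev c" k us vs d]) (auto simp: sum_list_rev)
    then show ?thesis by simp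
  qed
next
  assume "d = c \<or> d = rev c"
  then show "dihedral (k # c) (k # d)"
    by (auto simp: dihedral_refl dihedral_Cons_rev)
qed

lemma sum_list_two_le:
  fixes xs :: "nat list"
  assumes "x \<in> set xs" "y \<in> set xs" "x \<noteq> y"
  shows "x + y \<le> sum_list xs"
proof -
  obtain us vs where xs: "xs = us @ x # vs" using assms by (meson split_list)
  then have "y \<in> set (us @ vs)" using assms by auto
  then have "y \<le> sum_list (us @ vs)" by (intro member_le_sum_list) auto
  with xs show ?thesis by simp
qed

definition long_compositions :: "nat \<Rightarrow> nat list set" where
  "long_compositions n = {xs \<in> compositions n. \<exists>x\<in>set xs. n \<le> 2 * x}"

text \<open>A part of size at least \<open>n / 2\<close> can be rotated to the front; what remains is an arbitrary
  composition of some \<open>j \<le> n / 2\<close>, determined up to reversal.\<close>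

lemma card_long_classes:
  assumes n: "n > 0"
  shows "2 * card (long_compositions n // dihedral_rel (long_compositions n)) =
    (\<Sum>j\<le>n div 2. card (compositions j) + card {xs \<in> compositions j. rev xs = xs})"
proof -
  let ?X = "\<Union>j\<le>n div 2. compositions j"
  let ?R = "{(c, d). c \<in> ?X \<and> d \<in> ?X \<and> (d = c \<or> d = rev c)}"
  have X: "c \<in> ?X \<longleftrightarrow> 0 \<notin> set c \<and> 2 * sum_list c \<le> n" for c
    by (auto simp: compositions_def)
  have "card (?X // ?R) = card (long_compositions n // dihedral_rel (long_compositions n))"
  proof (rule card_quotient_transfer[where f = "\<lambda>c. (n - sum_list c) # c"])
    show "equiv ?X ?R"
      by (rule equivI) (auto simp: refl_on_def sym_def trans_def)
    show "equiv (long_compositions n) (dihedral_rel (long_compositions n))"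
      by (rule equiv_dihedral_rel)
    show mem: "(n - sum_list c) # c \<in> long_compositions n" if "c \<in> ?X" for c
      using that n unfolding X by (auto simp: long_compositions_def compositions_def)
    show "(c, d) \<in> ?R \<longleftrightarrow>
        ((n - sum_list c) # c, (n - sum_list d) # d) \<in> dihedral_rel (long_compositions n)"
      if c: "c \<in> ?X" and d: "d \<in> ?X" for c d
    proof -
      let ?k = "n - sum_list c" and ?l = "n - sum_list d"
      have cd: "0 \<notin> set c" "0 \<notin> set d" "2 * sum_list c \<le> n" "2 * sum_list d \<le> n"
        using c d unfolding X by auto
      \<comment> \<open>Two different leading parts would both occur in \<open>?l # d\<close> and
        sum to at most \<open>n\<close>. As each is at least half of \<open>n\<close>, both would be
        exactly half, hence equal.\<close>
      have kl: "?k = ?l" if "dihedral (?k # c) (?l # d)"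
      proof (rule ccontr)
        assume ne: "?k \<noteq> ?l"
        have "?k + ?l \<le> sum_list (?l # d)"
          using dihedral_set[OF that] ne by (intro sum_list_two_le) auto
        also have "\<dots> = n" using cd by simp
        finally show False using cd ne by linarith
      qed
      have "dihedral (?k # c) (?l # d) \<longleftrightarrow> d = c \<or> d = rev c"
      proof
        assume h: "dihedral (?k # c) (?l # d)"
        then show "d = c \<or> d = rev c"
          using dihedral_Cons_big_iff[of c ?k d] cd kl[OF h] by simp
      next
        assume h: "d = c \<or> d = rev c"
        then have "?l = ?k" by (auto simp: sum_list_rev)
        with h show "dihedral (?k # c) (?l # d)"
          using dihedral_Cons_big_iff[of c ?k d] cd by simp
      qed
      then show ?thesis
        using c d mem[OF c] mem[OF d] by (simp add: dihedral_rel_def)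
    qed
    fix xs assume xs: "xs \<in> long_compositions n"
    then obtain k where k: "k \<in> set xs" "n \<le> 2 * k"
      by (auto simp: long_compositions_def)
    then obtain us vs where uv: "xs = us @ k # vs"
      by (meson split_list)
    have "0 \<notin> set xs" "sum_list xs = n"
      using xs by (auto simp: long_compositions_def compositions_def)
    then have c: "vs @ us \<in> ?X" and k': "n - sum_list (vs @ us) = k"
      using k(2) unfolding X by (auto simp: uv)
    have "dihedral (k # vs @ us) xs"
      using dihedral_append_swap[of "k # vs" us] by (simp add: uv)
    then show "\<exists>c\<in>?X. ((n - sum_list c) # c, xs) \<in> dihedral_rel (long_compositions n)"
      using c mem[OF c] k' xs by (intro bexI[of _ "vs @ us"]) (simp_all add: dihedral_rel_def)
  qed
  moreover have "2 * card (?X // ?R) = card ?X + card {xs \<in> ?X. rev xs = xs}"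
  proof (rule card_reversal_classes)
    show "finite ?X" by (simp add: finite_compositions)
    show "rev xs \<in> ?X" if "xs \<in> ?X" for xs
      using that unfolding X by (simp add: sum_list_rev)
  qed simp
  moreover have "card ?X = (\<Sum>j\<le>n div 2. card (compositions j))"
    by (rule card_UN_disjoint) (simp_all add: finite_compositions, auto simp: compositions_def)
  moreover have "{xs \<in> ?X. rev xs = xs} = (\<Union>j\<le>n div 2. {xs \<in> compositions j. rev xs = xs})"
    by auto
  moreover have "card \<dots> = (\<Sum>j\<le>n div 2. card {xs \<in> compositions j. rev xs = xs})"
    by (rule card_UN_disjoint) (simp_all add: finite_compositions, auto simp: compositions_def)
  ultimately show ?thesis by (simp add: sum.distrib)
qed

section \<open>Evaluation of the sums and the closed form\<close>

lemma sum_card_compositions: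
  "(\<Sum>j\<le>h. card (compositions j) + card {xs \<in> compositions j. rev xs = xs}) + 2 =
    2 ^ h + (if even h then 3 else 4) * 2 ^ (h div 2)"
proof (induction h)
  case 0
  \<comment> \<open>The empty composition counts once as a composition and once as a palindrome;
    with the added 2 this gives 4 = 1 + 3.\<close>
  show ?case
    using card_palindromic_compositions[of 0] by (simp add: compositions_0 del: rev_is_Nil_conv)
next
  case (Suc h)
  \<comment> \<open>The palindromes of \<open>Suc h\<close> account for the alternation of 3 and 4:
    with \<open>q = h div 2\<close>, \<open>3 * 2 ^ q + 2 ^ q\<close> is \<open>4 * 2 ^ q\<close>
    for even \<open>h\<close>, and \<open>4 * 2 ^ q + 2 ^ (q + 1)\<close> is
    \<open>3 * 2 ^ (q + 1)\<close> for odd \<open>h\<close>.\<close>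
  have "(if even h then 3 else 4) * 2 ^ (h div 2) + 2 ^ (Suc h div 2) =
      (if even (Suc h) then 3 else 4) * (2 :: nat) ^ (Suc h div 2)"
  proof (cases "even h")
    case True
    then have "Suc h div 2 = h div 2" by presburger
    with True show ?thesis by simp
  next
    case False
    then have "Suc h div 2 = Suc (h div 2)" by presburger
    with False show ?thesis by simp
  qed
  then show ?case
    using Suc by (simp add: card_compositions card_palindromic_compositions)
qed

text \<open>For odd \<open>n\<close> exactly one of the two arcs \<open>k\<close> and
  \<open>n - k\<close> is odd, so the exponent is constant. For \<open>n = 2 * h\<close> the arcs
  are both even or both odd, \<open>h\<close> times each, with exponents \<open>h\<close> and
  \<open>h + 1\<close>.\<close>

lemma sum_reflections:
  "(\<Sum>k<n. 2 ^ ((n - k + 1) div 2 + (k + 1) div 2) :: nat) =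
    (if even n then 3 * (n div 2) * 2 ^ (n div 2) else n * 2 ^ ((n + 1) div 2))"
proof (cases "even n")
  case False
  have "(n - k + 1) div 2 + (k + 1) div 2 = (n + 1) div 2" if "k < n" for k
  proof -
    obtain m where "n = k + m" using \<open>k < n\<close> less_imp_add_positive by blast
    then have "(m + 1) div 2 + (k + 1) div 2 = (k + m + 1) div 2"
      using False by presburger
    with \<open>n = k + m\<close> show ?thesis by simp
  qed
  with False show ?thesis by simp
next
  case True
  then obtain h where h: "n = 2 * h" by blast
  have "(n - k + 1) div 2 + (k + 1) div 2 = (if even k then h else h + 1)" if "k < n" for k
  proof -
    obtain m where m: "n = k + m" using \<open>k < n\<close> less_imp_add_positive by blast
    with h have "k + m = 2 * h" by simp
    then have "(m + 1) div 2 + (k + 1) div 2 = (if even k then h else h + 1)"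
    proof (cases "even k")
      case True
      then obtain c where "k = 2 * c" by (elim evenE)
      moreover with \<open>k + m = 2 * h\<close> have "m = 2 * (h - c)" "c \<le> h" by auto
      ultimately show ?thesis by simp
    next
      case False
      then obtain c where "k = 2 * c + 1" by (elim oddE)
      moreover with \<open>k + m = 2 * h\<close> have "m = 2 * (h - c - 1) + 1" "c < h" by auto
      ultimately show ?thesis by simp
    qed
    with m show ?thesis by simp
  qed
  then have "(\<Sum>k<n. 2 ^ ((n - k + 1) div 2 + (k + 1) div 2) :: nat) =
      (\<Sum>k<2 * h. if even k then 2 ^ h else 2 ^ (h + 1))"
    unfolding h by (intro sum.cong) auto
  also have "\<dots> = 3 * h * 2 ^ h"
  proof -
    have "(\<Sum>k<2 * m. if even k then a else b) = m * (a + b)" for m a b :: nat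
      by (induction m) (auto simp: algebra_simps)
    then show ?thesis by simp
  qed
  finally show ?thesis using h by simp
qed

definition polygonal_compositions :: "nat \<Rightarrow> nat list set" where
  "polygonal_compositions n = {xs \<in> compositions n. \<forall>x\<in>set xs. 2 * x < n}"

text \<open>Bracelets are polygonal classes, long classes and the zero word. Multiplying by
  \<open>2 * n\<close> and keeping the subtracted classes on the left keeps the identity among
  natural numbers.\<close>

lemma card_polygonal_classes_nat:
  assumes n: "n > 0"
  shows "2 * n * (card (polygonal_compositions n // dihedral_rel (polygonal_compositions n)) + 1)
      + n * (\<Sum>j\<le>n div 2. card (compositions j) + card {xs \<in> compositions j. rev xs = xs})
    = (\<Sum>d | d dvd n. totient d * 2 ^ (n div d))
      + (\<Sum>k<n. 2 ^ ((n - k + 1) div 2 + (k + 1) div 2))"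
proof -
  have "long_compositions n = {xs \<in> compositions n. \<not> (\<forall>x\<in>set xs. 2 * x < n)}"
    by (auto simp: long_compositions_def not_less)
  then have "card (compositions n // dihedral_rel (compositions n)) =
      card (polygonal_compositions n // dihedral_rel (polygonal_compositions n))
      + card (long_compositions n // dihedral_rel (long_compositions n))"
    using card_dihedral_split[OF finite_compositions, of "\<lambda>xs. \<forall>x\<in>set xs. 2 * x < n" n]
    by (simp add: polygonal_compositions_def dihedral_set)
  then show ?thesis
    using card_bracelets[OF n] card_composition_classes[OF n] card_long_classes[OF n]
    by (simp add: algebra_simps)
qed

lemma card_polygonal_classes:
  assumes n: "n \<ge> 3"
  shows "real (card (polygonal_compositions n // dihedral_rel (polygonal_compositions n))) =
     (\<Sum>d | d dvd n. real (totient d) * 2 ^ (n div d - 1) / real n)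
     + 2 ^ ((n - 3) div 2)
     - (if [n = 0] (mod 4) \<or> [n = 1] (mod 4) then 3 * 2 ^ ((n - 4) div 4)
        else 2 ^ ((n + 2) div 4))"
proof -
  define h where "h = n div 2"
  define N where "N = real (card (polygonal_compositions n // dihedral_rel (polygonal_compositions n)))"
  define T where "T = (\<Sum>d | d dvd n. real (totient d) * 2 ^ (n div d - 1) / real n)"
  define L where "L = real (2 ^ h + (if even h then 3 else 4) * 2 ^ (h div 2))"
  define F where "F = (if even n then 3 * 2 ^ h / 2 else (2 :: real) ^ (h + 1))"
  have "real (\<Sum>d | d dvd n. totient d * 2 ^ (n div d)) =
      (\<Sum>d | d dvd n. 2 * real n * (real (totient d) * 2 ^ (n div d - 1) / real n))"
    unfolding of_nat_sum
  proof (rule sum.cong)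
    fix d assume "d \<in> {d. d dvd n}"
    then have "d dvd n" "n > 0" using n by auto
    then have "n div d > 0"
      using dvd_imp_le[of d n] dvd_pos_nat[of n d] by (simp add: div_greater_zero_iff)
    then have "(2::real) ^ (n div d) = 2 * 2 ^ (n div d - 1)"
      by (metis Suc_pred' power_Suc)
    then show "real (totient d * 2 ^ (n div d)) =
        2 * real n * (real (totient d) * 2 ^ (n div d - 1) / real n)"
      using n by simp
  qed simp
  then have T: "real (\<Sum>d | d dvd n. totient d * 2 ^ (n div d)) = 2 * real n * T"
    by (simp add: T_def sum_distrib_left)
  have L: "real (\<Sum>j\<le>n div 2. card (compositions j) + card {xs \<in> compositions j. rev xs = xs}) = L - 2"
    using arg_cong[OF sum_card_compositions[of h], of real] unfolding L_def h_def by linarith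
  have F: "real (\<Sum>k<n. 2 ^ ((n - k + 1) div 2 + (k + 1) div 2)) = real n * F"
  proof (cases "even n")
    case True
    then have "real n = 2 * real (n div 2)" by (auto elim!: evenE)
    with True show ?thesis
      unfolding sum_reflections F_def h_def by simp
  next
    case False
    then have "(n + 1) div 2 = n div 2 + 1" by presburger
    with False show ?thesis
      unfolding sum_reflections F_def h_def by simp
  qed
  have "2 * real n * (N + 1) + real n * (L - 2) = 2 * real n * T + real n * F"
    using arg_cong[OF card_polygonal_classes_nat[of n], of real] n
    unfolding of_nat_add of_nat_mult L T F N_def by simp
  then have "real n * (2 * (N + 1) + (L - 2)) = real n * (2 * T + F)"
    by (simp add: algebra_simps)
  then have "2 * (N + 1) + (L - 2) = 2 * T + F"
    using n by simp
  \<comment> \<open>The 1 for the zero word and the constant 2 in the count of long compositions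
    have cancelled.\<close>
  then have N: "N = T + (F - L) / 2"
    by (simp add: field_simps)
  define e where "e = n div 4"
  have "(F - L) / 2 = 2 ^ ((n - 3) div 2)
     - (if [n = 0] (mod 4) \<or> [n = 1] (mod 4) then 3 * 2 ^ ((n - 4) div 4)
        else 2 ^ ((n + 2) div 4))"
  proof -
    have "n mod 4 < 4" by simp
    then consider "n = 4 * e" | "n = 4 * e + 1" | "n = 4 * e + 2" | "n = 4 * e + 3"
      unfolding e_def by linarith
    then show ?thesis
    proof cases
      case 1
      \<comment> \<open>In the first three cases \<open>e = 0\<close> would mean
        \<open>n < 3\<close>. Writing \<open>e = Suc f\<close> makes the subtractions in the
        exponents exact.\<close>
      then obtain f where "e = Suc f" using n by (cases e) auto
      with 1 have nf: "n = 4 * f + 4" by simp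
      have "h = 2 * f + 2" "(n - 3) div 2 = 2 * f" "(n - 4) div 4 = f" "n mod 4 = 0"
        by (simp_all add: h_def nf)
      then show ?thesis by (simp add: F_def L_def nf cong_def power_add)
    next
      case 2
      then obtain f where "e = Suc f" using n by (cases e) auto
      with 2 have nf: "n = 4 * f + 5" by simp
      have "h = 2 * f + 2" "(n - 3) div 2 = 2 * f + 1" "(n - 4) div 4 = f" "n mod 4 = 1"
        unfolding h_def nf by presburger+
      then show ?thesis by (simp add: F_def L_def nf cong_def power_add)
    next
      case 3
      then obtain f where "e = Suc f" using n by (cases e) auto
      with 3 have nf: "n = 4 * f + 6" by simp
      have "h = 2 * f + 3" "(n - 3) div 2 = 2 * f + 1" "(n + 2) div 4 = f + 2" "n mod 4 = 2"
        unfolding h_def nf by presburger+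
      then show ?thesis by (simp add: F_def L_def nf cong_def power_add)
    next
      case 4
      have "h = 2 * e + 1" "(n - 3) div 2 = 2 * e" "(n + 2) div 4 = e + 1" "n mod 4 = 3"
        unfolding h_def 4 by presburger+
      then show ?thesis by (simp add: F_def L_def 4 cong_def power_add)
    qed
  qed
  with N show ?thesis by (simp add: N_def T_def)
qed

section \<open>Convex polygons inscribed in a circle\<close>

text \<open>Twice the signed area of the triangle: positive iff \<open>c\<close> lies strictly to
  the left of the line directed from \<open>a\<close> to \<open>b\<close>.\<close>

definition orient :: "complex \<Rightarrow> complex \<Rightarrow> complex \<Rightarrow> real" where
  "orient a b c = (Re b - Re a) * (Im c - Im a) - (Im b - Im a) * (Re c - Re a)"

lemma orient_rotate: "orient a b c = orient b c a"
  by (simp add: orient_def algebra_simps)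

lemma orient_eq_0_if_repeated [simp]: "orient a a c = 0" "orient a b a = 0" "orient a b b = 0"
  by (simp_all add: orient_def algebra_simps)

lemma orient_convex_combination:
  "orient a b ((1 - t) *\<^sub>R u + t *\<^sub>R v) = (1 - t) * orient a b u + t * orient a b v"
  by (simp add: orient_def algebra_simps)

lemma not_collinear_if_orient:
  assumes "orient a b c \<noteq> 0"
  shows "\<not> collinear {a, b, c}"
proof
  assume "collinear {a, b, c}"
  moreover have "a \<noteq> c" using assms by auto
  ultimately obtain t where b: "b = t *\<^sub>R a + (1 - t) *\<^sub>R c"
    by (auto simp: collinear_3_expand)
  have "orient a b c = 0" unfolding b by (simp add: orient_def algebra_simps)
  with assms show False by simp
qed

text \<open>The affine function \<open>orient a b\<close> vanishes on the first segment and is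
  nonnegative at \<open>u\<close> and \<open>v\<close>. It can vanish at a point of the second
  segment only if that point is an endpoint, or if \<open>u\<close> and \<open>v\<close> are both
  among \<open>a\<close> and \<open>b\<close>.\<close>

lemma segments_meet_in_endpoints:
  assumes ab: "a \<noteq> b" and uv: "u \<noteq> v"
    and u: "u \<in> {a, b} \<or> orient a b u > 0" and v: "v \<in> {a, b} \<or> orient a b v > 0"
    and ne: "{u, v} \<noteq> {a, b}"
  shows "closed_segment a b \<inter> closed_segment u v = {a, b} \<inter> {u, v}"
proof
  show "{a, b} \<inter> {u, v} \<subseteq> closed_segment a b \<inter> closed_segment u v" by auto
  show "closed_segment a b \<inter> closed_segment u v \<subseteq> {a, b} \<inter> {u, v}"
  proof
    fix p assume p: "p \<in> closed_segment a b \<inter> closed_segment u v"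
    then obtain s where "p = (1 - s) *\<^sub>R a + s *\<^sub>R b"
      by (auto simp: in_segment)
    then have 0: "orient a b p = 0"
      using orient_convex_combination[of a b s a b] by simp
    obtain t where t: "0 \<le> t" "t \<le> 1" "p = (1 - t) *\<^sub>R u + t *\<^sub>R v"
      using p by (auto simp: in_segment)
    have eq: "(1 - t) * orient a b u + t * orient a b v = 0"
      using 0 t orient_convex_combination by metis
    have nn: "orient a b u \<ge> 0" "orient a b v \<ge> 0"
      using u v by auto
    then have "(1 - t) * orient a b u = 0" "t * orient a b v = 0"
      using eq t by (smt (verit) mult_nonneg_nonneg)+
    then have "t = 1 \<or> u \<in> {a, b}" "t = 0 \<or> v \<in> {a, b}"
      using u v by auto
    then have "(t = 1 \<and> v \<in> {a, b}) \<or> (t = 0 \<and> u \<in> {a, b})"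
      using ne uv by auto
    then show "p \<in> {a, b} \<inter> {u, v}"
      using t by auto
  qed
qed

lemma polygon_if_strictly_convex:
  assumes len: "3 \<le> length vs"
    and pos: "\<And>i k. i < length vs \<Longrightarrow> k < length vs \<Longrightarrow> k \<noteq> i \<Longrightarrow> k \<noteq> Suc i mod length vs \<Longrightarrow>
      orient (vs ! i) (next_vertex vs i) (vs ! k) > 0"
  shows "polygon vs"
proof -
  let ?m = "length vs" and ?n = "\<lambda>i. Suc i mod length vs"
  have n: "?n i < ?m" "?n i \<noteq> i" "?n (?n i) \<noteq> i" "?n (?n i) \<noteq> ?n i" if "i < ?m" for i
    using that len by (auto simp: mod_Suc split: if_splits)
  have inj: "vs ! i \<noteq> vs ! j" if "i < ?m" "j < ?m" "i \<noteq> j" for i j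
  proof (cases "j = ?n i")
    case False
    then show ?thesis using pos[of i j] that by auto
  next
    case True
    \<comment> \<open>If two consecutive vertices coincided, the orientation with the vertex after
      them would be 0.\<close>
    then show ?thesis using pos[of i "?n (?n i)"] n[OF that(1)] n[of "?n i"] that
      by (auto simp: next_vertex_def)
  qed
  have inj': "vs ! i = vs ! j \<longleftrightarrow> i = j" if "i < ?m" "j < ?m" for i j
    using inj that by blast
  have "distinct vs"
    using inj by (auto simp: distinct_conv_nth)
  moreover have "side vs i \<inter> side vs j = {vs ! i, next_vertex vs i} \<inter> {vs ! j, next_vertex vs j}"
    if ij: "i < ?m" "j < ?m" "i \<noteq> j" for i j
    unfolding side_def
  proof (rule segments_meet_in_endpoints)
    show "vs ! i \<noteq> next_vertex vs i" "vs ! j \<noteq> next_vertex vs j"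
      using n[OF ij(1)] n[OF ij(2)] ij by (auto simp: next_vertex_def inj')
    have *: "vs ! k \<in> {vs ! i, next_vertex vs i} \<or> 0 < orient (vs ! i) (next_vertex vs i) (vs ! k)"
      if "k < ?m" for k
      using pos[of i k] ij that by (cases "k = i \<or> k = ?n i") (auto simp: next_vertex_def)
    show "vs ! j \<in> {vs ! i, next_vertex vs i} \<or> 0 < orient (vs ! i) (next_vertex vs i) (vs ! j)"
      using * ij by blast
    show "next_vertex vs j \<in> {vs ! i, next_vertex vs i} \<or>
        0 < orient (vs ! i) (next_vertex vs i) (next_vertex vs j)"
      using *[of "?n j"] n ij by (simp add: next_vertex_def)
    show "{vs ! j, next_vertex vs j} \<noteq> {vs ! i, next_vertex vs i}"
      using n[OF ij(1)] n[OF ij(2)] ij by (auto simp: doubleton_eq_iff next_vertex_def inj')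
  qed
  moreover have "\<not> collinear {vs ! i, next_vertex vs i, next_vertex vs (?n i)}" if "i < ?m" for i
  proof (rule not_collinear_if_orient)
    have "orient (vs ! i) (next_vertex vs i) (vs ! ?n (?n i)) > 0"
      using pos that n[OF that] n[OF n(1)[OF that]] by blast
    then show "orient (vs ! i) (next_vertex vs i) (next_vertex vs (?n i)) \<noteq> 0"
      by (simp add: next_vertex_def)
  qed
  ultimately show ?thesis
    using len by (simp add: polygon_def)
qed

text \<open>The factored form makes the sign visible: for increasing angles spanning less than a
  full turn, all three half differences lie in (0, \<open>pi\<close>) and all sines are
  positive.\<close>

lemma orient_circle:
  "orient (R *\<^sub>R cis \<alpha>) (R *\<^sub>R cis \<beta>) (R *\<^sub>R cis \<gamma>) =
    4 * R\<^sup>2 * (sin ((\<beta> - \<alpha>) / 2) * sin ((\<gamma> - \<beta>) / 2) * sin ((\<gamma> - \<alpha>) / 2))"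
proof -
  define x y where "x = (\<beta> - \<alpha>) / 2" and "y = (\<gamma> - \<beta>) / 2"
  have xy: "(\<gamma> - \<alpha>) / 2 = x + y" by (simp add: x_def y_def field_simps)
  have sum: "sin (2 * x) + sin (2 * y) - sin (2 * x + 2 * y) = 4 * (sin x * sin y * sin (x + y))"
  proof -
    \<comment> \<open>The double-angle identity as a polynomial identity in sines and cosines,
      modulo the two Pythagorean relations.\<close>
    have alg: "2 * s * c + 2 * r * d - 2 * (s * d + c * r) * (c * d - s * r) =
        4 * (s * r * (s * d + c * r))"
      if "c\<^sup>2 = 1 - s\<^sup>2" "d\<^sup>2 = 1 - r\<^sup>2" for c s d r :: real
    proof -
      have "2 * s * c + 2 * r * d - 2 * (s * d + c * r) * (c * d - s * r) =
          4 * (s * r * (s * d + c * r)) + 2 * s * c * (1 - r\<^sup>2 - d\<^sup>2) + 2 * r * d * (1 - s\<^sup>2 - c\<^sup>2)"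
        by (simp add: power2_eq_square algebra_simps)
      then show ?thesis using that by simp
    qed
    have "sin (2 * x + 2 * y) = 2 * (sin x * cos y + cos x * sin y) * (cos x * cos y - sin x * sin y)"
      using sin_double[of "x + y"] by (simp add: sin_add cos_add distrib_left)
    then show ?thesis
      using alg[OF cos_squared_eq cos_squared_eq, of x y]
      by (simp only: sin_double[of x] sin_double[of y] sin_add[of x y])
  qed
  have "orient (R *\<^sub>R cis \<alpha>) (R *\<^sub>R cis \<beta>) (R *\<^sub>R cis \<gamma>) =
      R\<^sup>2 * (sin (\<beta> - \<alpha>) + sin (\<gamma> - \<beta>) - sin (\<gamma> - \<alpha>))"
    by (simp add: orient_def sin_diff power2_eq_square algebra_simps)
  also have "\<beta> - \<alpha> = 2 * x" by (simp add: x_def field_simps)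
  also have "\<gamma> - \<beta> = 2 * y" by (simp add: y_def)
  also have "\<gamma> - \<alpha> = 2 * x + 2 * y" by (simp add: x_def y_def field_simps)
  finally show ?thesis
    unfolding sum xy by (simp add: x_def y_def)
qed

text \<open>Both sides are compared through their squares; the bound of one full turn keeps the sine
  of the half angle nonnegative.\<close>

lemma dist_circle:
  assumes "R \<ge> 0" "0 \<le> \<beta> - \<alpha>" "\<beta> - \<alpha> \<le> 2 * pi"
  shows "dist (R *\<^sub>R cis \<alpha>) (R *\<^sub>R cis \<beta>) = 2 * R * sin ((\<beta> - \<alpha>) / 2)"
proof -
  have "(dist (R *\<^sub>R cis \<alpha>) (R *\<^sub>R cis \<beta>))\<^sup>2 = R\<^sup>2 * (2 - 2 * cos (\<beta> - \<alpha>))"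
  proof -
    have alg: "(R * c - R * d)\<^sup>2 + (R * s - R * r)\<^sup>2 = R\<^sup>2 * (2 - 2 * (d * c + r * s))"
      if "c\<^sup>2 = 1 - s\<^sup>2" "d\<^sup>2 = 1 - r\<^sup>2" for c s d r :: real
    proof -
      have "(R * c - R * d)\<^sup>2 + (R * s - R * r)\<^sup>2 =
          R\<^sup>2 * (2 - 2 * (d * c + r * s)) - R\<^sup>2 * (1 - s\<^sup>2 - c\<^sup>2) - R\<^sup>2 * (1 - r\<^sup>2 - d\<^sup>2)"
        by (simp add: power2_eq_square algebra_simps)
      then show ?thesis using that by simp
    qed
    show ?thesis
      using alg[OF cos_squared_eq cos_squared_eq, of \<alpha> \<beta>]
      by (simp add: dist_norm cmod_power2 cos_diff)
  qed
  also have "cos (\<beta> - \<alpha>) = 1 - 2 * (sin ((\<beta> - \<alpha>) / 2))\<^sup>2"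
  proof -
    have "cos (\<beta> - \<alpha>) = cos (2 * ((\<beta> - \<alpha>) / 2))"
      by (rule arg_cong[of _ _ cos]) (simp add: field_simps)
    then show ?thesis by (simp only: cos_double_sin)
  qed
  also have "R\<^sup>2 * (2 - 2 * (1 - 2 * (sin ((\<beta> - \<alpha>) / 2))\<^sup>2)) = (2 * R * sin ((\<beta> - \<alpha>) / 2))\<^sup>2"
    by (simp add: power_mult_distrib)
  finally have "(dist (R *\<^sub>R cis \<alpha>) (R *\<^sub>R cis \<beta>))\<^sup>2 = (2 * R * sin ((\<beta> - \<alpha>) / 2))\<^sup>2" .
  moreover have "0 \<le> sin ((\<beta> - \<alpha>) / 2)"
    using assms by (intro sin_ge_zero) simp_all
  then have "0 \<le> 2 * R * sin ((\<beta> - \<alpha>) / 2)"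
    using assms(1) by simp
  ultimately show ?thesis
    by (rule power2_eq_imp_eq[OF _ zero_le_dist])
qed

text \<open>With \<open>t = 1 / (2 * R)\<close> this says that the chords of lengths \<open>bs\<close> of a circle of radius \<open>R\<close>,
  placed one after the other, span a chord of length \<open>a\<close>. Truncating the angle at \<open>pi\<close>
  makes the intermediate value theorem applicable on the whole interval of radii.\<close>

lemma exists_inscribing_radius:
  fixes a :: real and bs :: "real list"
  assumes a: "a > 0" and bs: "\<And>b. b \<in> set bs \<Longrightarrow> 0 < b \<and> b \<le> a" and sum: "a < sum_list bs"
  obtains t where "0 < t" "a * t \<le> 1" "(\<Sum>b\<leftarrow>bs. arcsin (b * t)) < pi"
    "sin (\<Sum>b\<leftarrow>bs. arcsin (b * t)) = a * t"
proof -
  define \<Theta> where "\<Theta> t = (\<Sum>b\<leftarrow>bs. arcsin (b * t))" for t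
  define f where "f t = sin (min (\<Theta> t) pi) - a * t" for t
  have "(\<Theta> has_real_derivative sum_list bs) (at 0)"
    unfolding \<Theta>_def
  proof (induction bs)
    case (Cons b bs)
    have "((\<lambda>t. arcsin (b * t)) has_real_derivative b) (at 0)"
      by (auto intro!: derivative_eq_intros)
    from DERIV_add[OF this Cons.IH] show ?case by simp
  qed simp
  moreover have \<Theta>0: "\<Theta> 0 = 0" by (simp add: \<Theta>_def sum_list_triv)
  \<comment> \<open>Here the polygon inequality enters: the slope \<open>sum_list bs - a\<close> at
    0 is positive, so for a very large circle the chords overshoot.\<close>
  ultimately have "((\<lambda>t. sin (\<Theta> t) - a * t) has_real_derivative (sum_list bs - a)) (at 0)"
    by (auto intro!: derivative_eq_intros)
  from DERIV_pos_inc_right[OF this] sum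
  obtain d where d: "d > 0" "\<And>h. 0 < h \<Longrightarrow> h < d \<Longrightarrow> 0 < sin (\<Theta> h) - a * h"
    by (auto simp: \<Theta>0)
  have "isCont \<Theta> 0"
    using \<open>(\<Theta> has_real_derivative sum_list bs) (at 0)\<close> by (rule DERIV_isCont)
  then have "(\<Theta> \<longlongrightarrow> 0) (at 0)"
    by (simp add: isCont_def \<Theta>0)
  then have "eventually (\<lambda>t. \<Theta> t < pi) (at 0)"
    by (rule order_tendstoD) simp
  then obtain e where e: "e > 0" "\<And>t. t \<noteq> 0 \<Longrightarrow> dist t 0 < e \<Longrightarrow> \<Theta> t < pi"
    unfolding eventually_at by auto
  \<comment> \<open>Small enough for the overshoot (\<open>d\<close>), for the truncation at
    \<open>pi\<close> to be inactive (\<open>e\<close>), and to lie below \<open>1 / a\<close>,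
    where the longest side is a diameter and \<open>f\<close> is at most 0.\<close>
  define s where "s = min (1 / a) (min d e) / 2"
  have s: "0 < s" "s < d" "s < e" "s < 1 / a"
    using a d(1) e(1) by (auto simp: s_def min_def divide_strict_right_mono)
  have "f s \<ge> 0"
    using d(2)[OF s(1,2)] e(2)[of s] s by (simp add: f_def min_def)
  moreover have "f (1 / a) \<le> 0"
    using a by (simp add: f_def)
  moreover have "continuous_on {s..1 / a} f"
  proof -
    have "continuous_on {s..1 / a} (\<lambda>t. \<Sum>b\<leftarrow>bs. arcsin (b * t))"
      using bs
    proof (induction bs)
      case (Cons b bs)
      have "0 < b" "b \<le> a" using Cons.prems by auto
      then have "-1 \<le> b * t \<and> b * t \<le> 1" if "t \<in> {s..1 / a}" for t
      proof -
        have "t > 0" "t * a \<le> 1" using that s a by (auto simp: field_simps)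
        moreover have bt: "b * t \<le> a * t" "b * t > 0"
          using \<open>0 < b\<close> \<open>b \<le> a\<close> \<open>t > 0\<close> by (auto intro: mult_right_mono)
        ultimately have "b * t \<le> 1" using mult.commute[of t a] by linarith
        with bt show ?thesis by simp
      qed
      then have "continuous_on {s..1 / a} (\<lambda>t. arcsin (b * t))"
        by (intro continuous_intros) auto
      moreover have "continuous_on {s..1 / a} (\<lambda>t. \<Sum>b\<leftarrow>bs. arcsin (b * t))"
        using Cons by simp
      ultimately show ?case by (simp add: continuous_on_add)
    qed simp
    then show ?thesis
      unfolding f_def \<Theta>_def by (intro continuous_intros)
  qed
  ultimately obtain t where t: "s \<le> t" "t \<le> 1 / a" "f t = 0"
    using IVT2'[of f "1 / a" 0 s] s by auto
  have "t > 0" "a * t \<le> 1" using t s a by (auto simp: field_simps)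
  moreover have "\<Theta> t < pi"
  proof (rule ccontr)
    assume "\<not> \<Theta> t < pi"
    then have "f t = - (a * t)" by (simp add: f_def min_def)
    with t a \<open>t > 0\<close> show False by simp
  qed
  moreover have "sin (\<Theta> t) = a * t"
    using t(3) \<open>\<Theta> t < pi\<close> by (simp add: f_def)
  ultimately show thesis using that unfolding \<Theta>_def by blast
qed

text \<open>The sides in \<open>bs\<close> subtend central angles of at most \<open>pi\<close>,
  given by arcsines that \<open>b \<le> a\<close> keeps meaningful. Only the closing side
  \<open>a\<close> may have an arc longer than a half turn.\<close>

lemma exists_polygon_last_longest:
  fixes a :: real and bs :: "real list"
  assumes a: "a > 0" and bs: "\<And>b. b \<in> set bs \<Longrightarrow> 0 < b \<and> b \<le> a" and sum: "a < sum_list bs"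
  obtains vs where "polygon vs" "side_lengths vs = bs @ [a]"
proof -
  obtain t where t: "0 < t" "a * t \<le> 1" "(\<Sum>b\<leftarrow>bs. arcsin (b * t)) < pi"
      "sin (\<Sum>b\<leftarrow>bs. arcsin (b * t)) = a * t"
    using exists_inscribing_radius[OF a bs sum] by blast
  define R where "R = 1 / (2 * t)"
  have R: "R > 0" using t by (simp add: R_def)
  define l where "l = length bs"
  \<comment> \<open>\<open>arcsin (bs ! i * t)\<close> is half the central angle of the chord, hence
    the factor 2.\<close>
  define \<phi> where "\<phi> k = 2 * (\<Sum>i<k. arcsin (bs ! i * t))" for k
  have arc: "0 < arcsin (bs ! i * t)" "sin (arcsin (bs ! i * t)) = bs ! i * t" if "i < l" for i
  proof -
    have b: "0 < bs ! i" "bs ! i \<le> a" using bs that by (auto simp: l_def)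
    have "bs ! i * t \<le> a * t" using b t by (auto intro: mult_right_mono)
    with t(2) have "bs ! i * t \<le> 1" by linarith
    moreover have "0 < bs ! i * t" using b t by simp
    ultimately show "0 < arcsin (bs ! i * t)" "sin (arcsin (bs ! i * t)) = bs ! i * t"
      using arcsin_less_arcsin[of 0 "bs ! i * t"] by auto
  qed
  have \<phi>_Suc: "\<phi> (Suc k) = \<phi> k + 2 * arcsin (bs ! k * t)" for k
    by (simp add: \<phi>_def)
  have \<phi>_less: "\<phi> i < \<phi> j" if "i < j" "j \<le> l" for i j
    using that
  proof (induction j)
    case (Suc j)
    then show ?case
      using arc(1)[of j] \<phi>_Suc[of j] by (cases "i = j") auto
  qed simp
  have \<phi>_l: "\<phi> l = 2 * (\<Sum>b\<leftarrow>bs. arcsin (b * t))"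
    by (simp add: \<phi>_def l_def sum_list_sum_nth atLeast0LessThan)
  then have \<phi>_l_less: "\<phi> l < 2 * pi" using t by simp
  have \<phi>_0: "\<phi> 0 = 0" by (simp add: \<phi>_def)
  have \<phi>_mono: "\<phi> i \<le> \<phi> j" if "i \<le> j" "j \<le> l" for i j
    using \<phi>_less[of i j] that by (cases "i = j") auto
  \<comment> \<open>A single side could not exceed \<open>a\<close> in sum, being at most
    \<open>a\<close> itself.\<close>
  have l: "l \<ge> 2"
  proof (rule ccontr)
    assume "\<not> l \<ge> 2"
    then have "l = 0 \<or> l = 1" by linarith
    then show False
      using bs sum a by (auto simp: l_def length_Suc_conv)
  qed
  define vs where "vs = map (\<lambda>k. R *\<^sub>R cis (\<phi> k)) [0..<Suc l]"
  have len: "length vs = Suc l" by (simp add: vs_def)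
  have nth: "vs ! k = R *\<^sub>R cis (\<phi> k)" if "k \<le> l" for k
    using that unfolding vs_def by (subst nth_map) (auto simp del: upt_Suc)
  have next_lt: "next_vertex vs k = R *\<^sub>R cis (\<phi> (Suc k))" if "k < l" for k
    using that nth[of "Suc k"] by (simp add: next_vertex_def len)
  have next_l: "next_vertex vs l = R *\<^sub>R cis (\<phi> 0)"
    using nth[of 0] by (simp add: next_vertex_def len)
  have orient_pos: "orient (R *\<^sub>R cis (\<phi> i)) (R *\<^sub>R cis (\<phi> j)) (R *\<^sub>R cis (\<phi> k)) > 0"
    if "i < j" "j < k" "k \<le> l" for i j k
  proof -
    have "\<phi> i < \<phi> j" "\<phi> j < \<phi> k" "\<phi> k \<le> \<phi> l" "\<phi> 0 \<le> \<phi> i"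
      using that by (auto intro: \<phi>_less \<phi>_mono)
    then have "sin ((\<phi> j - \<phi> i) / 2) > 0" "sin ((\<phi> k - \<phi> j) / 2) > 0" "sin ((\<phi> k - \<phi> i) / 2) > 0"
      using \<phi>_l_less \<phi>_0 by (auto intro!: sin_gt_zero)
    then show ?thesis
      using R by (simp add: orient_circle)
  qed
  have "polygon vs"
  proof (rule polygon_if_strictly_convex)
    show "3 \<le> length vs" using l len by simp
    fix i k assume ik: "i < length vs" "k < length vs" "k \<noteq> i" "k \<noteq> Suc i mod length vs"
    show "orient (vs ! i) (next_vertex vs i) (vs ! k) > 0"
    proof (cases "i = l")
      \<comment> \<open>For the closing side, from vertex \<open>l\<close> back to vertex 0, the
        triple is a cyclic shift of an increasing one, and \<open>orient\<close> is invariant under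
        such shifts.\<close>
      case True
      then have "0 < k" "k < l" using ik len by auto
      then have "orient (R *\<^sub>R cis (\<phi> 0)) (R *\<^sub>R cis (\<phi> k)) (R *\<^sub>R cis (\<phi> l)) > 0"
        by (intro orient_pos) auto
      then show ?thesis
        using True nth[of l] nth[of k] next_l \<open>k < l\<close> by (simp add: orient_rotate)
    next
      case False
      then have i: "i < l" "k \<le> l" "k \<noteq> Suc i" using ik len by auto
      consider "k < i" | "Suc i < k" using i ik by linarith
      then have "orient (R *\<^sub>R cis (\<phi> i)) (R *\<^sub>R cis (\<phi> (Suc i))) (R *\<^sub>R cis (\<phi> k)) > 0"
      proof cases
        case 1
        then show ?thesis using orient_pos[of k i "Suc i"] i by (simp add: orient_rotate)
      next
        case 2
        then show ?thesis using orient_pos[of i "Suc i" k] i by simp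
      qed
      then show ?thesis using nth[of i] nth[of k] next_lt i by simp
    qed
  qed
  moreover have "side_lengths vs = bs @ [a]"
  proof (rule nth_equalityI)
    show "length (side_lengths vs) = length (bs @ [a])"
      by (simp add: side_lengths_def len l_def)
    fix i assume "i < length (side_lengths vs)"
    then have i: "i \<le> l" by (simp add: side_lengths_def len)
    then have side: "side_lengths vs ! i = dist (vs ! i) (next_vertex vs i)"
      by (simp add: side_lengths_def len del: upt_Suc)
    show "side_lengths vs ! i = (bs @ [a]) ! i"
    proof (cases "i = l")
      case True
      have "dist (vs ! l) (next_vertex vs l) = dist (R *\<^sub>R cis (\<phi> 0)) (R *\<^sub>R cis (\<phi> l))"
        using nth[of l] next_l by (simp add: dist_commute)
      also have "\<dots> = 2 * R * sin ((\<phi> l - \<phi> 0) / 2)"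
        using R \<phi>_l_less \<phi>_0 \<phi>_mono[of 0 l] by (intro dist_circle) auto
      also have "\<dots> = a"
        using t by (simp add: \<phi>_0 \<phi>_l R_def)
      finally show ?thesis using True side by (simp add: l_def)
    next
      case False
      with i have "i < l" by simp
      have "\<phi> (Suc i) \<le> \<phi> l" "\<phi> 0 \<le> \<phi> i" "\<phi> i \<le> \<phi> (Suc i)"
        using \<open>i < l\<close> by (auto intro: \<phi>_mono)
      then have "dist (R *\<^sub>R cis (\<phi> i)) (R *\<^sub>R cis (\<phi> (Suc i))) = 2 * R * sin ((\<phi> (Suc i) - \<phi> i) / 2)"
        using R \<phi>_l_less \<phi>_0 by (intro dist_circle) auto
      also have "\<dots> = bs ! i"
        using arc(2)[OF \<open>i < l\<close>] t by (simp add: \<phi>_Suc R_def)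
      finally show ?thesis
        using side nth[of i] next_lt \<open>i < l\<close> by (simp add: nth_append l_def)
    qed
  qed
  ultimately show thesis by (rule that)
qed

section \<open>Necessity of the bound on the side lengths\<close>

lemma polygon_side_lt_half_perimeter:
  assumes "polygon vs" and x: "x \<in> set (side_lengths vs)"
  shows "2 * x < perimeter vs"
proof -
  define m where "m = length vs"
  \<comment> \<open>Periodic indexing lets the walk round the polygon start at any side.\<close>
  define V where "V k = vs ! (k mod m)" for k
  define D where "D k = dist (V k) (V (Suc k))" for k
  have m: "m \<ge> 3" using assms by (simp add: polygon_def m_def)
  have D: "D k = dist (vs ! (k mod m)) (next_vertex vs (k mod m))" for k
    by (simp add: D_def V_def next_vertex_def m_def mod_Suc_eq)
  have D_period: "D (k + m) = D k" for k
    by (simp add: D)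
  have "perimeter vs = (\<Sum>k<m. D k)"
    by (simp add: perimeter_def side_lengths_def D sum_list_sum_nth atLeast0LessThan m_def)
  moreover have shift: "(\<Sum>k=i..<i + m. D k) = (\<Sum>k<m. D k)" for i
  proof (induction i)
    case (Suc i)
    have "(\<Sum>k=i..<Suc (i + m). D k) = D i + (\<Sum>k=Suc i..<Suc (i + m). D k)"
      by (simp add: sum.atLeast_Suc_lessThan)
    moreover have "(\<Sum>k=i..<Suc (i + m). D k) = (\<Sum>k=i..<i + m. D k) + D (i + m)"
      by (rule sum.atLeastLessThan_Suc) simp
    ultimately show ?case using Suc D_period[of i] by simp
  qed (simp add: atLeast0LessThan)
  moreover obtain i where i: "i < m" "x = D i"
    using x by (auto simp: side_lengths_def D m_def)
  moreover have "D i < (\<Sum>k=Suc i..<i + m. D k)"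
  proof -
    have path: "dist (V a) (V (a + k)) \<le> (\<Sum>j=a..<a + k. D j)" for a k
    proof (induction k)
      case (Suc k)
      have "dist (V a) (V (a + Suc k)) \<le> dist (V a) (V (a + k)) + D (a + k)"
        by (simp add: D_def dist_triangle)
      with Suc show ?case by simp
    qed simp
    \<comment> \<open>Strictness comes from this one vertex, which is not a straight angle; along
      the rest of the walk the weak triangle inequality suffices.\<close>
    have "\<not> collinear {V i, V (Suc i), V (Suc (Suc i))}"
      using assms(1) i(1) by (auto simp: polygon_def V_def m_def next_vertex_def mod_Suc_eq)
    then have nb: "\<not> between (V (Suc i), V i) (V (Suc (Suc i)))"
      using between_imp_collinear by (metis insert_commute)
    have "D i = dist (V (Suc i)) (V i)"
      by (simp add: D_def dist_commute)
    also have "\<dots> < dist (V (Suc i)) (V (Suc (Suc i))) + dist (V (Suc (Suc i))) (V i)"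
      using nb dist_triangle[of "V (Suc i)" "V i" "V (Suc (Suc i))"] unfolding between by linarith
    \<comment> \<open>After the first two vertices of the detour, \<open>m - 2\<close> further sides
      lead back to \<open>V i\<close>.\<close>
    also have "V i = V (Suc (Suc i) + (m - 2))"
    proof -
      have "Suc (Suc i) + (m - 2) = i + m" using m by simp
      then show ?thesis by (simp only: V_def mod_add_self2)
    qed
    also have "dist (V (Suc (Suc i))) (V (Suc (Suc i) + (m - 2))) \<le> (\<Sum>k=Suc (Suc i)..<Suc (Suc i) + (m - 2). D k)"
      by (rule path)
    also have "Suc (Suc i) + (m - 2) = i + m" using m by simp
    also have "dist (V (Suc i)) (V (Suc (Suc i))) + (\<Sum>k=Suc (Suc i)..<i + m. D k) = (\<Sum>k=Suc i..<i + m. D k)"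
      using m by (simp add: D_def sum.atLeast_Suc_lessThan)
    finally show ?thesis by simp
  qed
  moreover have "(\<Sum>k=i..<i + m. D k) = D i + (\<Sum>k=Suc i..<i + m. D k)"
    using m by (simp add: sum.atLeast_Suc_lessThan)
  ultimately show ?thesis by simp
qed

section \<open>Side lengths of integer polygons\<close>

text \<open>The floor only changes the type; on integer polygons nothing is lost, by
  \<open>map_real_int_side_lengths\<close>.\<close>

definition int_side_lengths :: "complex list \<Rightarrow> nat list" where
  "int_side_lengths vs = map (\<lambda>l. nat \<lfloor>l\<rfloor>) (side_lengths vs)"

lemma map_real_int_side_lengths:
  assumes "integer_polygon vs"
  shows "map real (int_side_lengths vs) = side_lengths vs"
proof -
  have "real (nat \<lfloor>l\<rfloor>) = l" if "l \<in> set (side_lengths vs)" for l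
    using assms that by (auto simp: integer_polygon_def Ints_def)
  then show ?thesis
    by (simp add: int_side_lengths_def map_idI comp_def)
qed

lemma polygon_equiv_iff_dihedral:
  assumes "integer_polygon vs" "integer_polygon ws"
  shows "polygon_equiv vs ws \<longleftrightarrow> dihedral (int_side_lengths vs) (int_side_lengths ws)"
proof -
  have "polygon_equiv vs ws \<longleftrightarrow> dihedral (side_lengths vs) (side_lengths ws)"
  proof -
    have "length (side_lengths us) = length us" for us
      by (simp add: side_lengths_def)
    then have "length vs = length ws" if "dihedral (side_lengths vs) (side_lengths ws)"
      using dihedral_length[OF that] by simp
    then show ?thesis
      unfolding polygon_equiv_def using dihedral_def by blast
  qed
  also have "\<dots> \<longleftrightarrow> dihedral (map real (int_side_lengths vs)) (map real (int_side_lengths ws))"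
    using assms by (simp add: map_real_int_side_lengths)
  also have "\<dots> \<longleftrightarrow> dihedral (int_side_lengths vs) (int_side_lengths ws)"
  proof -
    have "map real xs = map real ys \<longleftrightarrow> xs = ys" for xs ys
      by (simp add: inj_map_eq_map inj_on_def)
    then show ?thesis
      unfolding dihedral_def by (simp add: rotate_map rev_map)
  qed
  finally show ?thesis .
qed

lemma sum_list_map_real: "sum_list (map real xs) = real (sum_list xs)"
  by (induction xs) auto

lemma int_side_lengths_polygonal:
  assumes "vs \<in> integer_polygons n"
  shows "int_side_lengths vs \<in> polygonal_compositions n"
proof -
  let ?xs = "int_side_lengths vs"
  have ip: "integer_polygon vs" and per: "perimeter vs = real n"
    using assms by (auto simp: integer_polygons_def)
  have xs: "map real ?xs = side_lengths vs"
    using ip by (rule map_real_int_side_lengths)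
  have "real (sum_list ?xs) = real n"
    using per unfolding perimeter_def xs[symmetric] by (simp add: sum_list_map_real)
  moreover have "x > 0" "2 * x < n" if "x \<in> set ?xs" for x
  proof -
    have "real x \<in> set (side_lengths vs)"
      using that unfolding xs[symmetric] by simp
    then have "real x > 0" "2 * real x < real n"
      using ip per polygon_side_lt_half_perimeter[of vs "real x"] by (auto simp: integer_polygon_def)
    then show "x > 0" "2 * x < n" by linarith+
  qed
  ultimately show ?thesis
    by (auto simp: polygonal_compositions_def compositions_def)
qed

text \<open>The construction puts a longest side last, so \<open>xs\<close> is realised only after a
  rotation that moves its maximum to the end. This is enough for
  \<open>card_quotient_transfer\<close>.\<close>

lemma exists_polygon_up_to_dihedral:
  assumes n: "n > 0" and xs: "xs \<in> polygonal_compositions n"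
  shows "\<exists>vs\<in>integer_polygons n. dihedral (int_side_lengths vs) xs"
proof -
  have xs': "0 \<notin> set xs" "sum_list xs = n" "\<And>x. x \<in> set xs \<Longrightarrow> 2 * x < n"
    using xs by (auto simp: polygonal_compositions_def compositions_def)
  have "xs \<noteq> []" using xs' n by auto
  define a where "a = Max (set xs)"
  have "a \<in> set xs" using \<open>xs \<noteq> []\<close> by (simp add: a_def)
  then obtain us vs where uv: "xs = us @ a # vs" by (meson split_list)
  define bs where "bs = vs @ us"
  have dih: "dihedral (bs @ [a]) xs"
    using dihedral_append_swap[of vs "us @ [a]"] by (simp add: uv bs_def)
  have b: "0 < b \<and> b \<le> a" if "b \<in> set bs" for b
  proof -
    have "b \<in> set xs" using that by (auto simp: uv bs_def)
    then show ?thesis using xs'(1) by (auto simp: a_def intro!: gr0I)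
  qed
  have "sum_list bs + a = n" using xs'(2) by (simp add: uv bs_def)
  moreover have "2 * a < n" using xs'(3) \<open>a \<in> set xs\<close> by blast
  ultimately have sum: "a < sum_list bs" by simp
  have "a > 0" using \<open>a \<in> set xs\<close> xs'(1) by (auto intro!: gr0I)
  obtain ps where ps: "polygon ps" "side_lengths ps = map real bs @ [real a]"
  proof (rule exists_polygon_last_longest[of "real a" "map real bs"])
    show "real a < sum_list (map real bs)"
      using sum by (simp add: sum_list_map_real)
  qed (use b \<open>a > 0\<close> in auto)
  have "int_side_lengths ps = bs @ [a]"
    by (simp add: int_side_lengths_def ps comp_def)
  moreover have "ps \<in> integer_polygons n"
    using ps b \<open>a > 0\<close> \<open>sum_list bs + a = n\<close>
    by (auto simp: integer_polygons_def integer_polygon_def perimeter_def sum_list_map_real)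
  ultimately show ?thesis using dih by metis
qed

lemma num_integer_polygons_eq:
  assumes "n > 0"
  shows "num_integer_polygons n =
    card (polygonal_compositions n // dihedral_rel (polygonal_compositions n))"
  unfolding num_integer_polygons_def
proof (rule card_quotient_transfer[where f = int_side_lengths])
  show "(vs, ws) \<in> polygon_rel n \<longleftrightarrow>
      (int_side_lengths vs, int_side_lengths ws) \<in> dihedral_rel (polygonal_compositions n)"
    if "vs \<in> integer_polygons n" "ws \<in> integer_polygons n" for vs ws
    using that int_side_lengths_polygonal polygon_equiv_iff_dihedral
    by (auto simp: polygon_rel_def dihedral_rel_def integer_polygons_def)
  show "\<exists>vs\<in>integer_polygons n. (int_side_lengths vs, xs) \<in> dihedral_rel (polygonal_compositions n)"
    if "xs \<in> polygonal_compositions n" for xs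
    using exists_polygon_up_to_dihedral[OF assms that] that int_side_lengths_polygonal
    by (auto simp: dihedral_rel_def)
qed (simp_all add: equiv_polygon_rel equiv_dihedral_rel int_side_lengths_polygonal)

theorem theorem1p6:
  fixes n :: nat
  assumes "n \<ge> 3"
  shows "real (num_integer_polygons n) =
     (\<Sum>d | d dvd n. real (totient d) * 2 ^ (n div d - 1) / real n)
     + 2 ^ ((n - 3) div 2)
     - (if [n = 0] (mod 4) \<or> [n = 1] (mod 4) then 3 * 2 ^ ((n - 4) div 4)
        else 2 ^ ((n + 2) div 4))"
  using card_polygonal_classes[OF assms] num_integer_polygons_eq[of n] assms by simp

end
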